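(* Let $(X_0,X_1)$ be a compatible couple of rearrangement invariant Köthe function spaces on the same measure space, let $0<\theta<1$, and suppose that the complex interpolation space $X_\theta=(X_0,X_1)_\theta$ is $L_2$ (with equivalent norms). Let $\Omega=\Omega_\theta$ be the centralizer on $L_2$ induced by this scale. Then $d_\Omega L_2$ admits a complex structure compatible with the natural complex structure $\omega$ on $L_2$; that is, there is a bounded linear operator $\beta$ on $d_\Omega L_2$ with $\beta^2=-\mathrm{id}$, $\beta(x,0)=(\omega(x),0)$ for all $x\in L_2$, and $q\beta=\omega q$, where $q(w,x)=x$.
   Context: Spaces in interpolation couples are complex. $(S,\mu)$ is a $\sigma$-finite measure space and $L_0$ is the space of measurable functions on it. A Köthe function space is a Banach space $X$ of (classes of) functions in $L_0$ such that $|f|\le|g|$ a.e. with $g\in X$ implies $f\in X$ and $\|f\|\le\|g\|$; it is rearrangement invariant if $\|f\|=\|g\|$ whenever $|f|$ and $|g|$ are equimeasurable (and $f\in X$ iff $g\in X$). Natural complex structure: let $\sigma:\mathbb N\to\mathbb N$ be the permutation exchanging $2n-1$ and $2n$ for each $n\ge1$. It is assumed that there is a partition $(S_n)_{n\ge 1}$ of $S$ into sets of positive measure with measure preserving bijections $a_n:S_n\to S_{\sigma(n)}$, with $a_{\sigma(n)}=a_n^{-1}$. Then $\omega(f)=\sum_n(-1)^n\,(f_{|S_{\sigma(n)}}\circ a_n)\,1_{S_n}$. (For sequence spaces, $S=\mathbb N$ and $\omega((x_n)_n)=((-1)^nx_{\sigma(n)})_n$.) Complex interpolation: a compatible couple $(X_0,X_1)$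 consists of complex Banach spaces continuously embedded in a common topological vector space (here $L_0$) with $\Delta=X_0\cap X_1$ dense in each; $\Sigma=X_0+X_1$ has norm $\|x\|_\Sigma=\inf\{\|x_0\|_0+\|x_1\|_1: x=x_0+x_1\}$. With $\mathbb S=\{z\in\mathbb C:0\le\operatorname{Re}z\le1\}$, $\mathcal H$ is the Banach space of functions $g:\mathbb S\to\Sigma$ that are $\|\cdot\|_\Sigma$-bounded and continuous on $\mathbb S$, analytic in the interior, and such that for $j=0,1$ one has $g(j+it)\in X_j$ for all real $t$ and $t\mapsto g(j+it)\in X_j$ is bounded and continuous, with norm $\|g\|_{\mathcal H}=\sup\{\|g(j+it)\|_j:j=0,1,\ t\in\mathbb R\}$. Put $\delta_\theta(g)=g(\theta)$, $\delta_\theta'(g)=g'(\theta)$; $X_\theta=\delta_\theta(\mathcal H)$ with the quotient norm $\|x\|_\theta=\inf\{\|g\|_{\mathcal H}:g(\theta)=x\}$. For $0<\theta<1$ choose a homogeneous map $B_\theta:X_\theta\to\mathcal H$ with $\delta_\theta B_\theta=\mathrm{id}$ and $\|B_\theta x\|_{\mathcal H}\le C\|x\|_\theta$ (bounded homogeneous selection) and set $\Omega_\theta=\delta_\theta'B_\theta:X_\theta\to\Sigma$; two choices of $B_\theta$ give maps $\Omega_\theta$ whose difference is bounded from $X_\theta$ to $X_\theta$. $d_{\Omega_\theta}X_\theta=\{(w,x): w\in\Sigma,\ x\in X_\theta,\ w-\Omega_\theta x\in X_\theta\}$ with quasi-norm $\|x\|_\theta+\|w-\Omega_\theta x\|_\theta$.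 A complex structure is a bounded linear operator whose square is $-\mathrm{id}$. *)

theory Defs
  imports "HOL-Analysis.Analysis"
begin

section \<open>The space of measurable functions modulo equality almost everywhere\<close>

type_synonym 's fclass = "('s \<Rightarrow> complex) set"

definition ae_rel :: "'s measure \<Rightarrow> (('s \<Rightarrow> complex) \<times> ('s \<Rightarrow> complex)) set" where
  "ae_rel M = {(f, g). f \<in> borel_measurable M \<and> g \<in> borel_measurable M \<and> (AE s in M. f s = g s)}"

definition L0 :: "'s measure \<Rightarrow> 's fclass set" where
  "L0 M = borel_measurable M // ae_rel M"

definition cls :: "'s measure \<Rightarrow> ('s \<Rightarrow> complex) \<Rightarrow> 's fclass" where
  "cls M f = ae_rel M `` {f}"

text \<open>
  Operations on classes are computed on a chosen representative. All operations below respect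
  equality almost everywhere, so the choice is immaterial.
\<close>

definition rep :: "'s fclass \<Rightarrow> 's \<Rightarrow> complex" where
  "rep F = (SOME f. f \<in> F)"

definition L0_zero :: "'s measure \<Rightarrow> 's fclass" where
  "L0_zero M = cls M (\<lambda>s. 0)"

definition L0_add :: "'s measure \<Rightarrow> 's fclass \<Rightarrow> 's fclass \<Rightarrow> 's fclass" where
  "L0_add M F G = cls M (\<lambda>s. rep F s + rep G s)"

definition L0_diff :: "'s measure \<Rightarrow> 's fclass \<Rightarrow> 's fclass \<Rightarrow> 's fclass" where
  "L0_diff M F G = cls M (\<lambda>s. rep F s - rep G s)"

definition L0_scale :: "'s measure \<Rightarrow> complex \<Rightarrow> 's fclass \<Rightarrow> 's fclass" where
  "L0_scale M c F = cls M (\<lambda>s. c * rep F s)"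

definition L0_sum :: "'s measure \<Rightarrow> (nat \<Rightarrow> 's fclass) \<Rightarrow> nat \<Rightarrow> 's fclass" where
  "L0_sum M F N = cls M (\<lambda>s. \<Sum>n<N. rep (F n) s)"

text \<open>
  The topology of \<^term>\<open>L0 M\<close> is convergence in measure on sets of finite measure; as the measure
  is \<open>\<sigma>\<close>-finite it is metrizable, so sequences suffice to express continuity.
\<close>

definition tendsto_L0 :: "'s measure \<Rightarrow> (nat \<Rightarrow> 's fclass) \<Rightarrow> 's fclass \<Rightarrow> bool" where
  "tendsto_L0 M u F \<longleftrightarrow>
     (\<forall>A\<in>fmeasurable M. \<forall>\<epsilon>>0.
        (\<lambda>n. measure M {s \<in> A. \<epsilon> \<le> cmod (rep (u n) s - rep F s)}) \<longlonglongrightarrow> 0)"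


section \<open>Banach spaces and Koethe function spaces inside the space of measurable functions\<close>

record 'v nspace =
  carr :: "'v set"
  nrm :: "'v \<Rightarrow> real"

definition normed_subspace :: "'s measure \<Rightarrow> 's fclass nspace \<Rightarrow> bool" where
  "normed_subspace M X \<longleftrightarrow>
     carr X \<subseteq> L0 M \<and> L0_zero M \<in> carr X \<and>
     (\<forall>F\<in>carr X. \<forall>G\<in>carr X. L0_add M F G \<in> carr X) \<and>
     (\<forall>c. \<forall>F\<in>carr X. L0_scale M c F \<in> carr X) \<and>
     (\<forall>F\<in>carr X. 0 \<le> nrm X F) \<and>
     (\<forall>F\<in>carr X. nrm X F = 0 \<longleftrightarrow> F = L0_zero M) \<and>
     (\<forall>c. \<forall>F\<in>carr X. nrm X (L0_scale M c F) = cmod c * nrm X F) \<and>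
     (\<forall>F\<in>carr X. \<forall>G\<in>carr X. nrm X (L0_add M F G) \<le> nrm X F + nrm X G)"

definition banach_subspace :: "'s measure \<Rightarrow> 's fclass nspace \<Rightarrow> bool" where
  "banach_subspace M X \<longleftrightarrow>
     normed_subspace M X \<and>
     (\<forall>u. (\<forall>n::nat. u n \<in> carr X) \<longrightarrow>
          (\<forall>e>0. \<exists>N. \<forall>m\<ge>N. \<forall>n\<ge>N. nrm X (L0_diff M (u m) (u n)) < e) \<longrightarrow>
          (\<exists>F\<in>carr X. (\<lambda>n. nrm X (L0_diff M (u n) F)) \<longlonglongrightarrow> 0))"

definition koethe_space :: "'s measure \<Rightarrow> 's fclass nspace \<Rightarrow> bool" where
  "koethe_space M X \<longleftrightarrow>
     banach_subspace M X \<and>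
     (\<forall>F\<in>L0 M. \<forall>G\<in>carr X. (AE s in M. cmod (rep F s) \<le> cmod (rep G s)) \<longrightarrow>
        F \<in> carr X \<and> nrm X F \<le> nrm X G)"

definition equimeasurable :: "'s measure \<Rightarrow> 's fclass \<Rightarrow> 's fclass \<Rightarrow> bool" where
  "equimeasurable M F G \<longleftrightarrow>
     (\<forall>t\<ge>0. emeasure M {s \<in> space M. t < cmod (rep F s)} = emeasure M {s \<in> space M. t < cmod (rep G s)})"

definition rearrangement_invariant :: "'s measure \<Rightarrow> 's fclass nspace \<Rightarrow> bool" where
  "rearrangement_invariant M X \<longleftrightarrow>
     (\<forall>F\<in>L0 M. \<forall>G\<in>L0 M. equimeasurable M F G \<longrightarrow>
        (F \<in> carr X \<longleftrightarrow> G \<in> carr X) \<and> (F \<in> carr X \<longrightarrow> nrm X F = nrm X G))"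

definition L2_space :: "'s measure \<Rightarrow> 's fclass nspace" where
  "L2_space M =
     \<lparr>carr = {F \<in> L0 M. integrable M (\<lambda>s. (cmod (rep F s))\<^sup>2)},
      nrm = (\<lambda>F. sqrt (\<integral>s. (cmod (rep F s))\<^sup>2 \<partial>M))\<rparr>"

definition equal_with_equivalent_norms :: "'v nspace \<Rightarrow> 'v nspace \<Rightarrow> bool" where
  "equal_with_equivalent_norms X Y \<longleftrightarrow>
     carr X = carr Y \<and>
     (\<exists>k>0. \<exists>K>0. \<forall>F\<in>carr X. k * nrm Y F \<le> nrm X F \<and> nrm X F \<le> K * nrm Y F)"


section \<open>Complex interpolation\<close>

definition continuously_embedded :: "'s measure \<Rightarrow> 's fclass nspace \<Rightarrow> bool" where
  "continuously_embedded M X \<longleftrightarrow>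
     (\<forall>u. \<forall>F\<in>carr X. (\<forall>n. u n \<in> carr X) \<longrightarrow> (\<lambda>n. nrm X (L0_diff M (u n) F)) \<longlonglongrightarrow> 0 \<longrightarrow>
        tendsto_L0 M u F)"

definition dense_in :: "'s measure \<Rightarrow> 's fclass set \<Rightarrow> 's fclass nspace \<Rightarrow> bool" where
  "dense_in M D X \<longleftrightarrow> (\<forall>F\<in>carr X. \<forall>e>0. \<exists>G\<in>D. nrm X (L0_diff M F G) < e)"

definition compatible_couple :: "'s measure \<Rightarrow> 's fclass nspace \<Rightarrow> 's fclass nspace \<Rightarrow> bool" where
  "compatible_couple M X0 X1 \<longleftrightarrow>
     banach_subspace M X0 \<and> banach_subspace M X1 \<and>
     continuously_embedded M X0 \<and> continuously_embedded M X1 \<and>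
     dense_in M (carr X0 \<inter> carr X1) X0 \<and> dense_in M (carr X0 \<inter> carr X1) X1"

definition sum_space :: "'s measure \<Rightarrow> 's fclass nspace \<Rightarrow> 's fclass nspace \<Rightarrow> 's fclass nspace" where
  "sum_space M X0 X1 =
     \<lparr>carr = {L0_add M F0 F1 | F0 F1. F0 \<in> carr X0 \<and> F1 \<in> carr X1},
      nrm = (\<lambda>F. Inf {nrm X0 F0 + nrm X1 F1 | F0 F1.
                      F0 \<in> carr X0 \<and> F1 \<in> carr X1 \<and> F = L0_add M F0 F1})\<rparr>"

definition bounded_map_on :: "'v nspace \<Rightarrow> 'a set \<Rightarrow> ('a \<Rightarrow> 'v) \<Rightarrow> bool" where
  "bounded_map_on X D g \<longleftrightarrow> (\<exists>K. \<forall>z\<in>D. nrm X (g z) \<le> K)"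

definition norm_continuous_on ::
    "'s measure \<Rightarrow> 's fclass nspace \<Rightarrow> 'a::topological_space set \<Rightarrow> ('a \<Rightarrow> 's fclass) \<Rightarrow> bool" where
  "norm_continuous_on M X D g \<longleftrightarrow>
     (\<forall>z\<in>D. ((\<lambda>w. nrm X (L0_diff M (g w) (g z))) \<longlongrightarrow> 0) (at z within D))"

text \<open>Vector-valued analyticity: locally the sum of a norm-convergent power series.\<close>

definition norm_analytic_on ::
    "'s measure \<Rightarrow> 's fclass nspace \<Rightarrow> complex set \<Rightarrow> (complex \<Rightarrow> 's fclass) \<Rightarrow> bool" where
  "norm_analytic_on M X D g \<longleftrightarrow>
     (\<forall>z\<in>D. \<exists>r>0. \<exists>c. (\<forall>n. c n \<in> carr X) \<and>
        (\<forall>w\<in>ball z r.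
           (\<lambda>N. nrm X (L0_diff M (L0_sum M (\<lambda>n. L0_scale M ((w - z) ^ n) (c n)) N) (g w))) \<longlonglongrightarrow> 0))"

definition has_norm_derivative ::
    "'s measure \<Rightarrow> 's fclass nspace \<Rightarrow> (complex \<Rightarrow> 's fclass) \<Rightarrow> 's fclass \<Rightarrow> complex \<Rightarrow> bool" where
  "has_norm_derivative M X g d z \<longleftrightarrow>
     d \<in> carr X \<and>
     ((\<lambda>w. nrm X (L0_diff M (L0_scale M (1 / (w - z)) (L0_diff M (g w) (g z))) d)) \<longlongrightarrow> 0) (at z)"

definition norm_deriv ::
    "'s measure \<Rightarrow> 's fclass nspace \<Rightarrow> (complex \<Rightarrow> 's fclass) \<Rightarrow> complex \<Rightarrow> 's fclass" where
  "norm_deriv M X g z = (THE d. has_norm_derivative M X g d z)"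

definition strip :: "complex set" where
  "strip = {z. 0 \<le> Re z \<and> Re z \<le> 1}"

definition boundary_condition ::
    "'s measure \<Rightarrow> 's fclass nspace \<Rightarrow> real \<Rightarrow> (complex \<Rightarrow> 's fclass) \<Rightarrow> bool" where
  "boundary_condition M X j g \<longleftrightarrow>
     (\<forall>t::real. g (Complex j t) \<in> carr X) \<and>
     bounded_map_on X UNIV (\<lambda>t::real. g (Complex j t)) \<and>
     norm_continuous_on M X UNIV (\<lambda>t::real. g (Complex j t))"

text \<open>Only the values on the strip matter for a member of the space below.\<close>

definition calderon_space ::
    "'s measure \<Rightarrow> 's fclass nspace \<Rightarrow> 's fclass nspace \<Rightarrow> (complex \<Rightarrow> 's fclass) nspace" where
  "calderon_space M X0 X1 =
     \<lparr>carr = {g. (\<forall>z\<in>strip. g z \<in> carr (sum_space M X0 X1)) \<and>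
                 bounded_map_on (sum_space M X0 X1) strip g \<and>
                 norm_continuous_on M (sum_space M X0 X1) strip g \<and>
                 norm_analytic_on M (sum_space M X0 X1) (interior strip) g \<and>
                 boundary_condition M X0 0 g \<and> boundary_condition M X1 1 g},
      nrm = (\<lambda>g. Sup (range (\<lambda>t. nrm X0 (g (Complex 0 t))) \<union> range (\<lambda>t. nrm X1 (g (Complex 1 t)))))\<rparr>"

definition interpolation_space ::
    "'s measure \<Rightarrow> 's fclass nspace \<Rightarrow> 's fclass nspace \<Rightarrow> real \<Rightarrow> 's fclass nspace" where
  "interpolation_space M X0 X1 \<theta> =
     \<lparr>carr = (\<lambda>g. g (complex_of_real \<theta>)) ` carr (calderon_space M X0 X1),
      nrm = (\<lambda>F. Inf {nrm (calderon_space M X0 X1) g | g.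
                      g \<in> carr (calderon_space M X0 X1) \<and> g (complex_of_real \<theta>) = F})\<rparr>"

definition bounded_homogeneous_selection ::
    "'s measure \<Rightarrow> 's fclass nspace \<Rightarrow> 's fclass nspace \<Rightarrow> real \<Rightarrow> ('s fclass \<Rightarrow> complex \<Rightarrow> 's fclass) \<Rightarrow> bool" where
  "bounded_homogeneous_selection M X0 X1 \<theta> B \<longleftrightarrow>
     (\<forall>F\<in>carr (interpolation_space M X0 X1 \<theta>).
        B F \<in> carr (calderon_space M X0 X1) \<and> B F (complex_of_real \<theta>) = F) \<and>
     (\<forall>c. \<forall>F\<in>carr (interpolation_space M X0 X1 \<theta>). \<forall>z\<in>strip.
        B (L0_scale M c F) z = L0_scale M c (B F z)) \<and>
     (\<exists>C. \<forall>F\<in>carr (interpolation_space M X0 X1 \<theta>).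
        nrm (calderon_space M X0 X1) (B F) \<le> C * nrm (interpolation_space M X0 X1 \<theta>) F)"

definition induced_centralizer ::
    "'s measure \<Rightarrow> 's fclass nspace \<Rightarrow> 's fclass nspace \<Rightarrow> real \<Rightarrow> ('s fclass \<Rightarrow> complex \<Rightarrow> 's fclass)
       \<Rightarrow> 's fclass \<Rightarrow> 's fclass" where
  "induced_centralizer M X0 X1 \<theta> B F = norm_deriv M (sum_space M X0 X1) (B F) (complex_of_real \<theta>)"


section \<open>Derived spaces and complex structures\<close>

text \<open>Here the \<open>nrm\<close> component is a quasi-norm; \<open>W\<close> is the ambient space of the first coordinate.\<close>

definition derived_space ::
    "'s measure \<Rightarrow> 's fclass nspace \<Rightarrow> 's fclass nspace \<Rightarrow> ('s fclass \<Rightarrow> 's fclass)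
       \<Rightarrow> ('s fclass \<times> 's fclass) nspace" where
  "derived_space M W X \<Omega> =
     \<lparr>carr = {(w, x). w \<in> carr W \<and> x \<in> carr X \<and> L0_diff M w (\<Omega> x) \<in> carr X},
      nrm = (\<lambda>(w, x). nrm X x + nrm X (L0_diff M w (\<Omega> x)))\<rparr>"

definition pair_add ::
    "'s measure \<Rightarrow> 's fclass \<times> 's fclass \<Rightarrow> 's fclass \<times> 's fclass \<Rightarrow> 's fclass \<times> 's fclass" where
  "pair_add M u v = (L0_add M (fst u) (fst v), L0_add M (snd u) (snd v))"

definition pair_scale ::
    "'s measure \<Rightarrow> complex \<Rightarrow> 's fclass \<times> 's fclass \<Rightarrow> 's fclass \<times> 's fclass" where
  "pair_scale M c v = (L0_scale M c (fst v), L0_scale M c (snd v))"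

definition bounded_linear_operator ::
    "'s measure \<Rightarrow> ('s fclass \<times> 's fclass) nspace \<Rightarrow> ('s fclass \<times> 's fclass \<Rightarrow> 's fclass \<times> 's fclass) \<Rightarrow> bool" where
  "bounded_linear_operator M D T \<longleftrightarrow>
     (\<forall>v\<in>carr D. T v \<in> carr D) \<and>
     (\<forall>u\<in>carr D. \<forall>v\<in>carr D. T (pair_add M u v) = pair_add M (T u) (T v)) \<and>
     (\<forall>c. \<forall>v\<in>carr D. T (pair_scale M c v) = pair_scale M c (T v)) \<and>
     (\<exists>K. \<forall>v\<in>carr D. nrm D (T v) \<le> K * nrm D v)"

definition complex_structure ::
    "'s measure \<Rightarrow> ('s fclass \<times> 's fclass) nspace \<Rightarrow> ('s fclass \<times> 's fclass \<Rightarrow> 's fclass \<times> 's fclass) \<Rightarrow> bool" where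
  "complex_structure M D T \<longleftrightarrow>
     bounded_linear_operator M D T \<and> (\<forall>v\<in>carr D. T (T v) = pair_scale M (-1) v)"


section \<open>The natural complex structure\<close>

text \<open>The permutation of the positive integers exchanging \<open>2n - 1\<close> and \<open>2n\<close>.\<close>

definition swap_perm :: "nat \<Rightarrow> nat" where
  "swap_perm n = (if odd n then n + 1 else n - 1)"

definition measure_preserving_bij :: "'s measure \<Rightarrow> 's set \<Rightarrow> 's set \<Rightarrow> ('s \<Rightarrow> 's) \<Rightarrow> bool" where
  "measure_preserving_bij M A A' f \<longleftrightarrow>
     bij_betw f A A' \<and>
     f \<in> measurable (restrict_space M A) (restrict_space M A') \<and>
     (\<forall>E\<in>sets M. E \<subseteq> A' \<longrightarrow> emeasure M (f -` E \<inter> A) = emeasure M E)"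

text \<open>The pieces \<open>S n\<close> and the maps \<open>a n\<close> are indexed by \<open>n \<ge> 1\<close>; their values at \<open>0\<close> are irrelevant.\<close>

definition natural_structure_data :: "'s measure \<Rightarrow> (nat \<Rightarrow> 's set) \<Rightarrow> (nat \<Rightarrow> 's \<Rightarrow> 's) \<Rightarrow> bool" where
  "natural_structure_data M S a \<longleftrightarrow>
     (\<forall>n\<ge>1. S n \<in> sets M \<and> emeasure M (S n) > 0) \<and>
     disjoint_family_on S {1..} \<and> (\<Union>n\<in>{1..}. S n) = space M \<and>
     (\<forall>n\<ge>1. measure_preserving_bij M (S n) (S (swap_perm n)) (a n)) \<and>
     (\<forall>n\<ge>1. \<forall>s\<in>S (swap_perm n). a (swap_perm n) s = inv_into (S n) (a n) s)"

definition natural_complex_structure ::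
    "'s measure \<Rightarrow> (nat \<Rightarrow> 's set) \<Rightarrow> (nat \<Rightarrow> 's \<Rightarrow> 's) \<Rightarrow> 's fclass \<Rightarrow> 's fclass" where
  "natural_complex_structure M S a F =
     cls M (\<lambda>s. \<Sum>n. if n \<ge> 1 \<and> s \<in> S n then (-1) ^ n * rep F (a n s) else 0)"

end

theory Submission
  imports Defs
begin

text \<open>
  The required operator is \<open>\<beta> (w, x) = (\<omega> w, \<omega> x)\<close>. As \<open>\<omega> f = \<epsilon> (f \<circ> \<tau>)\<close> with a unimodular \<open>\<epsilon>\<close>
  and a measure preserving involution \<open>\<tau>\<close>, it is isometric on every rearrangement invariant space
  and contractive on the sum space, so it acts on the Calderon space by composition. For \<open>x\<close> in \<open>L\<^sub>2\<close>
  the function \<open>h = \<omega> (B x) - B (\<omega> x)\<close> lies in the Calderon space and vanishes at \<open>\<theta>\<close>. Hence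
  \<open>k z = h z / (z - \<theta>)\<close>, with \<open>k \<theta> = h' \<theta>\<close>, again lies in the Calderon space: \<open>1 / (z - \<theta>)\<close> is bounded on
  the boundary and away from \<open>\<theta>\<close>, so no conformal map of the strip is needed. Therefore
  \<open>\<omega> (\<Omega> x) - \<Omega> (\<omega> x) = k \<theta>\<close> has norm \<open>O(\<parallel>x\<parallel>)\<close> in the interpolation space, which makes \<open>\<beta>\<close> bounded.
\<close>

section \<open>Classes of measurable functions\<close>

text \<open>The derivative in \<open>\<Omega>\<close> is a definite description taken in the sum
  space, so its value is usable only once the infimum norm of the sum is definite; this is where
  sigma-finiteness and the continuous embeddings into \<open>L0\<close> enter. Analyticity means
  local power series expansion, so the division by \<open>z - \<theta>\<close> is carried out on
  coefficients: at \<open>\<theta>\<close> they shift by one place, elsewhere a recursion with a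
  geometric bound produces them. The Calderon norm is a supremum over the two boundary lines, where
  \<open>|z - \<theta>|\<close> is at least \<open>min \<theta> (1 - \<theta>)\<close>; this is the
  constant of the estimate, while boundedness and continuity of \<open>k\<close> in the sum norm
  across the strip are separate membership conditions. Although \<open>\<Omega>\<close> may fail to
  be linear, \<open>\<beta>\<close> is linear, because \<open>\<Omega>\<close> enters only the
  domain and the quasi-norm of the derived space. The analysis runs on functions instead of classes,
  at the price that equality often weakens to equality up to a function of seminorm zero.\<close>

lemma equiv_ae_rel: "equiv (borel_measurable M) (ae_rel M)"
proof (rule equivI)
  show "ae_rel M \<subseteq> borel_measurable M \<times> borel_measurable M"
    by (auto simp: ae_rel_def)
  show "refl_on (borel_measurable M) (ae_rel M)"
    by (auto simp: refl_on_def ae_rel_def)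
  show "sym (ae_rel M)"
    by (auto simp: sym_def ae_rel_def elim: eventually_mono)
  show "trans (ae_rel M)"
    unfolding trans_def ae_rel_def by (auto elim: eventually_elim2)
qed

lemma cls_eq_iff:
  assumes "f \<in> borel_measurable M" "g \<in> borel_measurable M"
  shows "cls M f = cls M g \<longleftrightarrow> (AE s in M. f s = g s)"
  using eq_equiv_class_iff[OF equiv_ae_rel assms] assms by (simp add: cls_def ae_rel_def)

lemma cls_in_L0: "f \<in> borel_measurable M \<Longrightarrow> cls M f \<in> L0 M"
  by (simp add: cls_def L0_def quotientI)

lemma
  assumes "f \<in> borel_measurable M"
  shows rep_cls_measurable: "rep (cls M f) \<in> borel_measurable M"
    and rep_cls_AE: "AE s in M. rep (cls M f) s = f s"
proof -
  have "f \<in> cls M f"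
    using assms by (simp add: cls_def ae_rel_def)
  then have "rep (cls M f) \<in> cls M f"
    unfolding rep_def by (rule someI[of "\<lambda>f. f \<in> cls M _"])
  then have "(f, rep (cls M f)) \<in> ae_rel M" by (simp add: cls_def)
  then show "rep (cls M f) \<in> borel_measurable M" "AE s in M. rep (cls M f) s = f s"
    by (auto simp: ae_rel_def elim: eventually_mono)
qed

lemma
  assumes "F \<in> L0 M"
  shows rep_measurable: "rep F \<in> borel_measurable M" and cls_rep: "cls M (rep F) = F"
proof -
  obtain f where f: "f \<in> borel_measurable M" "F = cls M f"
    using assms by (auto simp: L0_def cls_def elim: quotientE)
  show m: "rep F \<in> borel_measurable M" using f rep_cls_measurable by auto
  have "cls M (rep F) = cls M f"
    by (subst cls_eq_iff[OF m f(1)]) (use f rep_cls_AE in auto)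
  then show "cls M (rep F) = F" using f by simp
qed

lemma L0E:
  assumes "F \<in> L0 M"
  obtains f where "f \<in> borel_measurable M" "F = cls M f"
  using rep_measurable[OF assms] cls_rep[OF assms] by metis

lemma L0_add_cls:
  assumes [measurable]: "f \<in> borel_measurable M" "g \<in> borel_measurable M"
  shows "L0_add M (cls M f) (cls M g) = cls M (\<lambda>s. f s + g s)"
  using rep_cls_AE[OF assms(1)] rep_cls_AE[OF assms(2)] rep_cls_measurable[OF assms(1)] rep_cls_measurable[OF assms(2)]
  unfolding L0_add_def by (subst cls_eq_iff) (auto elim: eventually_elim2)

lemma L0_diff_cls:
  assumes [measurable]: "f \<in> borel_measurable M" "g \<in> borel_measurable M"
  shows "L0_diff M (cls M f) (cls M g) = cls M (\<lambda>s. f s - g s)"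
  using rep_cls_AE[OF assms(1)] rep_cls_AE[OF assms(2)] rep_cls_measurable[OF assms(1)] rep_cls_measurable[OF assms(2)]
  unfolding L0_diff_def by (subst cls_eq_iff) (auto elim: eventually_elim2)

lemma L0_scale_cls:
  assumes [measurable]: "f \<in> borel_measurable M"
  shows "L0_scale M c (cls M f) = cls M (\<lambda>s. c * f s)"
  using rep_cls_AE[OF assms(1)] rep_cls_measurable[OF assms(1)]
  unfolding L0_scale_def by (subst cls_eq_iff) (auto elim: eventually_mono)

lemma L0_sum_cls:
  assumes [measurable]: "\<And>n. f n \<in> borel_measurable M"
  shows "L0_sum M (\<lambda>n. cls M (f n)) N = cls M (\<lambda>s. \<Sum>n<N. f n s)"
proof -
  note [measurable] = rep_cls_measurable[OF assms]
  have "AE s in M. \<forall>n. rep (cls M (f n)) s = f n s"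
    using rep_cls_AE[OF assms] by (simp add: AE_all_countable)
  then show ?thesis
    unfolding L0_sum_def by (subst cls_eq_iff) (auto elim: eventually_mono)
qed

lemmas L0_cls_simps = L0_add_cls L0_diff_cls L0_scale_cls L0_sum_cls L0_zero_def

lemma L0_power_series_cls:
  assumes [measurable]: "\<And>n. c n \<in> borel_measurable M" "g \<in> borel_measurable M"
  shows "L0_diff M (L0_sum M (\<lambda>n. L0_scale M (u n) (cls M (c n))) N) (cls M g) =
    cls M (\<lambda>s. (\<Sum>n<N. u n * c n s) - g s)"
  by (simp add: L0_cls_simps)

section \<open>Function spaces with a seminorm\<close>

text \<open>Definiteness is left out on purpose: the intended instance is a norm on classes pulled
  back to functions, and it vanishes on every measurable function that is zero almost everywhere.
  Conditions such as \<open>p (G z) = 0\<close> stand in for \<open>G z = 0\<close>.\<close>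

locale function_seminorm =
  fixes V :: "('s \<Rightarrow> complex) set" and p :: "('s \<Rightarrow> complex) \<Rightarrow> real"
  assumes zero_mem: "(\<lambda>s. 0) \<in> V"
    and add_mem: "f \<in> V \<Longrightarrow> g \<in> V \<Longrightarrow> (\<lambda>s. f s + g s) \<in> V"
    and scale_mem: "f \<in> V \<Longrightarrow> (\<lambda>s. c * f s) \<in> V"
    and nonneg: "f \<in> V \<Longrightarrow> 0 \<le> p f"
    and homogeneous: "f \<in> V \<Longrightarrow> p (\<lambda>s. c * f s) = cmod c * p f"
    and triangle: "f \<in> V \<Longrightarrow> g \<in> V \<Longrightarrow> p (\<lambda>s. f s + g s) \<le> p f + p g"
begin

lemma diff_mem: "f \<in> V \<Longrightarrow> g \<in> V \<Longrightarrow> (\<lambda>s. f s - g s) \<in> V"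
  using add_mem[of f "\<lambda>s. (-1) * g s"] scale_mem[of g "-1"] by simp

lemma homogeneous_divide: "f \<in> V \<Longrightarrow> p (\<lambda>s. f s / c) = p f / cmod c"
  using homogeneous[of f "1 / c"] by (simp add: norm_divide)

lemma sum_mem: "(\<And>n. f n \<in> V) \<Longrightarrow> (\<lambda>s. \<Sum>n<(N::nat). f n s) \<in> V"
  by (induction N) (auto intro: zero_mem add_mem)

lemmas mem_intros = zero_mem add_mem scale_mem diff_mem sum_mem

lemma seminorm_zero: "p (\<lambda>s. 0) = 0"
  using homogeneous[OF zero_mem, of 0] by simp

lemma triangle_diff: "f \<in> V \<Longrightarrow> g \<in> V \<Longrightarrow> p (\<lambda>s. f s - g s) \<le> p f + p g"
  using triangle[of f "\<lambda>s. (-1) * g s"] scale_mem[of g "-1"] homogeneous[of g "-1"] by simp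

lemma seminorm_diff_commute: "f \<in> V \<Longrightarrow> g \<in> V \<Longrightarrow> p (\<lambda>s. f s - g s) = p (\<lambda>s. g s - f s)"
  using homogeneous[of "\<lambda>s. f s - g s" "-1"] diff_mem[of f g] by simp

lemma triangle_via: "f \<in> V \<Longrightarrow> g \<in> V \<Longrightarrow> h \<in> V \<Longrightarrow>
    p (\<lambda>s. f s - h s) \<le> p (\<lambda>s. f s - g s) + p (\<lambda>s. g s - h s)"
  using triangle[of "\<lambda>s. f s - g s" "\<lambda>s. g s - h s"] by (simp add: diff_mem)

lemma seminorm_le_diff: "f \<in> V \<Longrightarrow> g \<in> V \<Longrightarrow> p f \<le> p g + p (\<lambda>s. f s - g s)"
  using triangle[of g "\<lambda>s. f s - g s"] by (simp add: diff_mem)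

section \<open>Power series with values in a seminormed function space\<close>

definition expands :: "(complex \<Rightarrow> 's \<Rightarrow> complex) \<Rightarrow> (nat \<Rightarrow> 's \<Rightarrow> complex) \<Rightarrow> complex \<Rightarrow> real \<Rightarrow> bool" where
  "expands G c z r \<longleftrightarrow> 0 < r \<and> (\<forall>n. c n \<in> V) \<and> (\<forall>w\<in>ball z r. G w \<in> V) \<and>
     (\<forall>w\<in>ball z r. (\<lambda>N. p (\<lambda>s. (\<Sum>n<N. (w - z) ^ n * c n s) - G w s)) \<longlonglongrightarrow> 0)"

text \<open>In contrast to \<open>norm_analytic_on\<close>, the ball has to lie in \<open>D\<close>,
  which guarantees values in \<open>V\<close> on all of it. For open \<open>D\<close> the two
  notions agree after shrinking the radius.\<close>

definition analytic :: "complex set \<Rightarrow> (complex \<Rightarrow> 's \<Rightarrow> complex) \<Rightarrow> bool" where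
  "analytic D G \<longleftrightarrow> (\<forall>z\<in>D. \<exists>r c. ball z r \<subseteq> D \<and> expands G c z r)"

definition cont :: "'a::topological_space set \<Rightarrow> ('a \<Rightarrow> 's \<Rightarrow> complex) \<Rightarrow> bool" where
  "cont D G \<longleftrightarrow> (\<forall>z\<in>D. ((\<lambda>w. p (\<lambda>s. G w s - G z s)) \<longlongrightarrow> 0) (at z within D))"

lemma expands_mem:
  assumes "expands G c z r" "w \<in> ball z r"
  shows "(\<lambda>s. \<Sum>n<N. (w - z) ^ n * c n s) \<in> V" "G w \<in> V" "c n \<in> V"
  using assms by (auto simp: expands_def intro!: mem_intros)

lemma expands_shrink: "expands G c z r \<Longrightarrow> 0 < r' \<Longrightarrow> r' \<le> r \<Longrightarrow> expands G c z r'"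
  by (auto simp: expands_def)

lemma expands_radius: "expands G c z r \<Longrightarrow> 0 < r"
  by (simp add: expands_def)

lemma expands_tendsto:
  "expands G c z r \<Longrightarrow> w \<in> ball z r \<Longrightarrow> (\<lambda>N. p (\<lambda>s. (\<Sum>n<N. (w - z) ^ n * c n s) - G w s)) \<longlonglongrightarrow> 0"
  by (simp add: expands_def)

lemma expands_diff:
  assumes G: "expands G c z r" and H: "expands H d z r"
  shows "expands (\<lambda>w s. G w s - H w s) (\<lambda>n s. c n s - d n s) z r"
  unfolding expands_def
proof (intro conjI allI ballI)
  show "0 < r" using G by (rule expands_radius)
  show "(\<lambda>s. c n s - d n s) \<in> V" for n
    using G H by (auto simp: expands_def intro!: diff_mem)
next
  fix w assume w: "w \<in> ball z r"
  note mG = expands_mem[OF G w] and mH = expands_mem[OF H w]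
  show "(\<lambda>s. G w s - H w s) \<in> V" by (intro diff_mem mG(2) mH(2))
  have "(\<lambda>N. p (\<lambda>s. (\<Sum>n<N. (w - z) ^ n * c n s) - G w s) + p (\<lambda>s. (\<Sum>n<N. (w - z) ^ n * d n s) - H w s)) \<longlonglongrightarrow> 0 + 0"
    by (rule tendsto_add[OF expands_tendsto[OF G w] expands_tendsto[OF H w]])
  then have lim: "(\<lambda>N. p (\<lambda>s. (\<Sum>n<N. (w - z) ^ n * c n s) - G w s) + p (\<lambda>s. (\<Sum>n<N. (w - z) ^ n * d n s) - H w s)) \<longlonglongrightarrow> 0"
    by simp
  have eq: "(\<lambda>s. (\<Sum>n<N. (w - z) ^ n * (c n s - d n s)) - (G w s - H w s)) =
    (\<lambda>s. ((\<Sum>n<N. (w - z) ^ n * c n s) - G w s) - ((\<Sum>n<N. (w - z) ^ n * d n s) - H w s))" for N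
    by (rule ext) (simp add: right_diff_distrib sum_subtractf)
  show "(\<lambda>N. p (\<lambda>s. (\<Sum>n<N. (w - z) ^ n * (c n s - d n s)) - (G w s - H w s))) \<longlonglongrightarrow> 0"
    unfolding eq by (rule tendsto_sandwich[OF _ _ tendsto_const lim])
      (auto intro!: always_eventually nonneg triangle_diff diff_mem mG(1,2) mH(1,2))
qed

text \<open>This takes the place of Cauchy's estimate. At the point \<open>z + \<rho>\<close>
  consecutive partial sums differ by \<open>\<rho> ^ n * c n\<close>, and the distances of the
  partial sums to their limit are bounded because they converge.\<close>

lemma expands_coeff_bound:
  assumes G: "expands G c z r" and rho: "0 < \<rho>" "\<rho> < r"
  obtains K where "\<And>n. p (c n) * \<rho> ^ n \<le> K"
proof -
  define w where "w = z + of_real \<rho>"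
  have w: "w \<in> ball z r" using rho by (simp add: w_def dist_norm)
  note m = expands_mem[OF G w]
  define \<delta> where "\<delta> N = p (\<lambda>s. (\<Sum>n<N. (w - z) ^ n * c n s) - G w s)" for N
  have "\<delta> \<longlonglongrightarrow> 0" using expands_tendsto[OF G w] unfolding \<delta>_def .
  then have "Bseq \<delta>" by (intro convergent_imp_Bseq convergentI)
  then obtain K where K: "\<And>n. \<bar>\<delta> n\<bar> \<le> K" by (auto simp: Bseq_def)
  have "p (c n) * \<rho> ^ n \<le> K + K" for n
  proof -
    have "p (c n) * \<rho> ^ n = p (\<lambda>s. (w - z) ^ n * c n s)"
      using homogeneous[of "c n" "(w - z) ^ n"] m rho by (simp add: w_def norm_power)
    also have "(\<lambda>s. (w - z) ^ n * c n s) =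
      (\<lambda>s. ((\<Sum>n<Suc n. (w - z) ^ n * c n s) - G w s) - ((\<Sum>n<n. (w - z) ^ n * c n s) - G w s))"
      by (rule ext) simp
    also have "p \<dots> \<le> \<delta> (Suc n) + \<delta> n"
      unfolding \<delta>_def by (intro triangle_diff diff_mem m)
    also have "\<dots> \<le> K + K" using K[of n] K[of "Suc n"] by linarith
    finally show ?thesis .
  qed
  then show ?thesis by (rule that)
qed

text \<open>At the center every partial sum with at least one term equals \<open>c 0\<close>, since
  \<open>0 ^ 0 = 1\<close>. The limit determines \<open>c 0\<close> only up to seminorm
  zero.\<close>

lemma expands_center:
  assumes "expands G c z r"
  shows "p (\<lambda>s. c 0 s - G z s) = 0"
proof -
  have z: "z \<in> ball z r" using assms by (simp add: expands_def)
  have "(\<Sum>n<Suc N. (z - z) ^ n * c n s) = c 0 s" for N s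
    by (subst sum.lessThan_Suc_shift) simp
  then have "(\<lambda>N. p (\<lambda>s. c 0 s - G z s)) \<longlonglongrightarrow> 0"
    using LIMSEQ_Suc[OF expands_tendsto[OF assms z]] by simp
  then show ?thesis by (simp add: LIMSEQ_const_iff)
qed

lemma sum_power_le_2:
  assumes "0 \<le> (q::real)" "q \<le> 1/2"
  shows "(\<Sum>n<N. q ^ n) \<le> 2"
proof -
  have eq: "(\<Sum>n<N. q ^ n) = (1 - q ^ N) / (1 - q)"
    using assms by (simp add: sum_gp_strict)
  have "1 - q ^ N \<le> 1" using assms by simp
  also have "1 \<le> 2 * (1 - q)" using assms by simp
  finally show ?thesis unfolding eq using assms by (simp add: divide_le_eq)
qed

text \<open>Subtracting \<open>c 0\<close> and \<open>(w - z) * c 1\<close> leaves terms of order at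
  least two. For \<open>|w - z|\<close> below \<open>\<rho> / 2\<close> they are dominated by a
  geometric series of ratio at most 1/2 and have size at most
  \<open>2 * K * |w - z|^2 / \<rho>^2\<close>; division by \<open>w - z\<close> leaves a quantity of
  first order.\<close>

lemma expands_derivative:
  assumes G: "expands G c z r"
  shows "((\<lambda>w. p (\<lambda>s. 1 / (w - z) * (G w s - G z s) - c 1 s)) \<longlongrightarrow> 0) (at z)"
proof -
  define \<rho> where "\<rho> = r / 2"
  have rho: "0 < \<rho>" "\<rho> < r" using expands_radius[OF G] by (auto simp: \<rho>_def)
  obtain K where K: "\<And>n. p (c n) * \<rho> ^ n \<le> K"
    using expands_coeff_bound[OF G rho] by blast
  have z: "z \<in> ball z r" using rho by simp
  note mz = expands_mem[OF G z]
  have K0: "0 \<le> K" using K[of 0] nonneg[OF mz(3)[of 0]] by simp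
  have bound: "p (\<lambda>s. 1 / (w - z) * (G w s - G z s) - c 1 s) \<le> (2 * K / \<rho>^2) * cmod (w - z)"
    if w: "dist w z < \<rho> / 2" "w \<noteq> z" for w
  proof -
    define u where "u = w - z"
    have u: "u \<noteq> 0" "cmod u \<le> \<rho> / 2" using w by (auto simp: u_def dist_norm)
    have wb: "w \<in> ball z r" using w rho by (simp add: dist_commute)
    note m = expands_mem[OF G wb, folded u_def]
    \<comment> \<open>Only finitely many terms from order two on: \<open>V\<close> carries no
      completeness, so the tail is bounded through its partial sums, uniformly in
      \<open>N\<close>.\<close>
    define T where "T N = (\<lambda>s. \<Sum>n<N. u ^ (n + 2) * c (n + 2) s)" for N
    have mT: "T N \<in> V" for N
      unfolding T_def by (intro sum_mem scale_mem m)
    define q where "q = cmod u / \<rho>"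
    have q: "0 \<le> q" "q \<le> 1/2" using u rho by (auto simp: q_def field_simps)
    have "p (T N) \<le> K * q^2 * (\<Sum>n<N. q ^ n)" for N
    proof (induction N)
      case 0 then show ?case by (simp add: T_def seminorm_zero)
    next
      case (Suc N)
      have "p (T (Suc N)) \<le> p (T N) + p (\<lambda>s. u ^ (N + 2) * c (N + 2) s)"
        using triangle[OF mT[of N] scale_mem[OF m(3)[of "N+2"], of "u ^ (N + 2)"]] by (simp add: T_def)
      also have "p (\<lambda>s. u ^ (N + 2) * c (N + 2) s) = q ^ (N + 2) * (p (c (N + 2)) * \<rho> ^ (N + 2))"
        unfolding homogeneous[OF m(3)] using rho by (simp add: q_def norm_power norm_mult power_divide field_simps)
      also have "\<dots> \<le> q ^ (N + 2) * K"
        using K[of "N + 2"] q by (intro mult_left_mono) auto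
      finally show ?case using Suc by (simp add: algebra_simps power2_eq_square)
    qed
    also have "K * q^2 * (\<Sum>n<N. q ^ n) \<le> K * q^2 * 2" for N
      using K0 q by (intro mult_left_mono sum_power_le_2) auto
    finally have T: "p (T N) \<le> 2 * K * q^2" for N by (simp add: mult.assoc mult.commute mult.left_commute)
    define R where "R = (\<lambda>s. (G w s - G z s) - u * c 1 s)"
    have mR: "R \<in> V" unfolding R_def by (intro diff_mem scale_mem m mz)
    \<comment> \<open>\<open>R\<close> does not depend on \<open>N\<close>, so the truncation error
      on the right can be sent to zero afterwards.\<close>
    have "p R \<le> 2 * K * q^2 + p (\<lambda>s. (\<Sum>n<Suc (Suc N). u ^ n * c n s) - G w s)" for N
    proof -
      have mS: "(\<lambda>s. (\<Sum>n<Suc (Suc N). u ^ n * c n s) - G w s) \<in> V"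
        by (intro diff_mem m)
      have R_eq: "R = (\<lambda>s. (T N s - ((\<Sum>n<Suc (Suc N). u ^ n * c n s) - G w s)) + (c 0 s - G z s))"
        unfolding R_def T_def by (rule ext) (simp add: sum.lessThan_Suc_shift del: sum.lessThan_Suc)
      have "p R \<le> p (\<lambda>s. T N s - ((\<Sum>n<Suc (Suc N). u ^ n * c n s) - G w s)) + p (\<lambda>s. c 0 s - G z s)"
        unfolding R_eq by (intro triangle diff_mem mT m mz)
      also have "\<dots> \<le> (p (T N) + p (\<lambda>s. (\<Sum>n<Suc (Suc N). u ^ n * c n s) - G w s)) + 0"
        using expands_center[OF G] by (intro add_mono triangle_diff mT mS) simp
      finally show ?thesis using T[of N] by linarith
    qed
    moreover have "(\<lambda>N. 2 * K * q^2 + p (\<lambda>s. (\<Sum>n<Suc (Suc N). u ^ n * c n s) - G w s)) \<longlonglongrightarrow> 2 * K * q^2 + 0"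
      using LIMSEQ_Suc[OF LIMSEQ_Suc[OF expands_tendsto[OF G wb]]] unfolding u_def
      by (intro tendsto_add tendsto_const)
    ultimately have R: "p R \<le> 2 * K * q^2"
      by (intro LIMSEQ_le_const[of _ "2 * K * q^2"]) auto
    have "(\<lambda>s. 1 / (w - z) * (G w s - G z s) - c 1 s) = (\<lambda>s. (1 / u) * R s)"
      using u by (auto simp: R_def u_def field_simps)
    then have "p (\<lambda>s. 1 / (w - z) * (G w s - G z s) - c 1 s) = p R / cmod u"
      by (simp add: homogeneous_divide[OF mR])
    also have "\<dots> \<le> 2 * K * q^2 / cmod u"
      using R by (intro divide_right_mono) auto
    also have "\<dots> = (2 * K / \<rho>^2) * cmod (w - z)"
      using u by (simp add: q_def u_def[symmetric] power2_eq_square field_simps)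
    finally show ?thesis .
  qed
  have ev: "\<forall>\<^sub>F w in at z. dist w z < \<rho> / 2 \<and> w \<noteq> z"
    using rho by (auto simp: eventually_at intro!: exI[of _ "\<rho>/2"])
  have "((\<lambda>w. (2 * K / \<rho>^2) * cmod (w - z)) \<longlongrightarrow> (2 * K / \<rho>^2) * cmod (z - z)) (at z)"
    by (intro tendsto_intros)
  then have lim: "((\<lambda>w. (2 * K / \<rho>^2) * cmod (w - z)) \<longlongrightarrow> 0) (at z)" by simp
  show ?thesis
  proof (rule tendsto_sandwich[OF _ _ tendsto_const lim])
    show "\<forall>\<^sub>F w in at z. 0 \<le> p (\<lambda>s. 1 / (w - z) * (G w s - G z s) - c 1 s)"
      using ev
    proof eventually_elim
      case (elim w)
      then have "w \<in> ball z r" using rho by (simp add: dist_commute)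
      then show ?case by (intro nonneg diff_mem scale_mem mz expands_mem[OF G])
    qed
    show "\<forall>\<^sub>F w in at z. p (\<lambda>s. 1 / (w - z) * (G w s - G z s) - c 1 s) \<le> (2 * K / \<rho>^2) * cmod (w - z)"
      using ev by eventually_elim (rule bound; simp)
  qed
qed

end

section \<open>Dividing an analytic function by a linear factor\<close>

text \<open>Coefficients of \<open>G w / (w - a)\<close> around \<open>z\<close>, where \<open>d = z - a\<close>: they solve
  \<open>(d + u) * (\<Sum>n. u ^ n * e n) = (\<Sum>n. u ^ n * c n)\<close>.\<close>

primrec quotient_coeff :: "complex \<Rightarrow> (nat \<Rightarrow> 's \<Rightarrow> complex) \<Rightarrow> nat \<Rightarrow> 's \<Rightarrow> complex" where
  "quotient_coeff d c 0 = (\<lambda>s. c 0 s / d)"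
| "quotient_coeff d c (Suc n) = (\<lambda>s. (c (Suc n) s - quotient_coeff d c n s) / d)"

text \<open>The recursion says \<open>d * e n = c n - e (n - 1)\<close> for positive
  \<open>n\<close>, so the product telescopes and only the top term \<open>u ^ Suc N * e N\<close>
  survives as an error.\<close>

lemma quotient_coeff_sum:
  assumes "d \<noteq> 0"
  shows "(d + u) * (\<Sum>n<Suc N. u ^ n * quotient_coeff d c n s) =
    (\<Sum>n<Suc N. u ^ n * c n s) + u ^ Suc N * quotient_coeff d c N s"
proof (induction N)
  case 0
  then show ?case using assms by (simp add: field_simps)
next
  case (Suc N)
  have "d * quotient_coeff d c (Suc N) s = c (Suc N) s - quotient_coeff d c N s"
    using assms by simp
  then have "(d + u) * (u ^ Suc N * quotient_coeff d c (Suc N) s) =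
    u ^ Suc N * (c (Suc N) s - quotient_coeff d c N s) + u ^ Suc (Suc N) * quotient_coeff d c (Suc N) s"
    by (metis (no_types, opaque_lifting) distrib_right mult.commute mult.left_commute power_Suc)
  with Suc show ?case
    by (subst sum.lessThan_Suc, subst (2) sum.lessThan_Suc) (simp only: distrib_left, simp add: algebra_simps)
qed

text \<open>\<open>f\<close> is the value at \<open>a\<close>, later the derivative of \<open>G\<close> there.\<close>

definition removed :: "complex \<Rightarrow> ('s \<Rightarrow> complex) \<Rightarrow> (complex \<Rightarrow> 's \<Rightarrow> complex) \<Rightarrow> complex \<Rightarrow> 's \<Rightarrow> complex" where
  "removed a f G z = (if z = a then f else (\<lambda>s. 1 / (z - a) * G z s))"

context function_seminorm
begin

lemma seminorm_cong:
  assumes "f \<in> V" "g \<in> V" "p (\<lambda>s. f s - g s) = 0"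
  shows "p f = p g"
  using seminorm_le_diff[of f g] seminorm_le_diff[of g f] seminorm_diff_commute[of f g] assms by simp

lemma cont_diff:
  assumes "\<And>z. z \<in> D \<Longrightarrow> G z \<in> V" "\<And>z. z \<in> D \<Longrightarrow> H z \<in> V" "cont D G" "cont D H"
  shows "cont D (\<lambda>z s. G z s - H z s)"
  unfolding cont_def
proof
  fix z assume z: "z \<in> D"
  have "((\<lambda>w. p (\<lambda>s. G w s - G z s) + p (\<lambda>s. H w s - H z s)) \<longlongrightarrow> 0 + 0) (at z within D)"
    using assms(3,4) z by (intro tendsto_add) (auto simp: cont_def)
  then have lim: "((\<lambda>w. p (\<lambda>s. G w s - G z s) + p (\<lambda>s. H w s - H z s)) \<longlongrightarrow> 0) (at z within D)"
    by simp
  have eq: "(\<lambda>s. (G w s - H w s) - (G z s - H z s)) = (\<lambda>s. (G w s - G z s) - (H w s - H z s))" for w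
    by (rule ext) simp
  have ev: "\<forall>\<^sub>F w in at z within D. w \<in> D"
    by (simp add: eventually_at_filter)
  show "((\<lambda>w. p (\<lambda>s. G w s - H w s - (G z s - H z s))) \<longlongrightarrow> 0) (at z within D)"
    unfolding eq
  proof (rule tendsto_sandwich[OF _ _ tendsto_const lim])
    show "\<forall>\<^sub>F w in at z within D. 0 \<le> p (\<lambda>s. (G w s - G z s) - (H w s - H z s))"
      using ev by eventually_elim (auto intro!: nonneg diff_mem assms z)
    show "\<forall>\<^sub>F w in at z within D. p (\<lambda>s. (G w s - G z s) - (H w s - H z s))
        \<le> p (\<lambda>s. G w s - G z s) + p (\<lambda>s. H w s - H z s)"
      using ev by eventually_elim (auto intro!: triangle_diff diff_mem assms z)
  qed
qed

lemma cont_scale: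
  assumes mem: "\<And>z. z \<in> D \<Longrightarrow> G z \<in> V" and G: "cont D G" and u: "continuous_on D u"
  shows "cont D (\<lambda>z s. u z * G z s)"
  unfolding cont_def
proof
  fix z assume z: "z \<in> D"
  have uz: "(u \<longlongrightarrow> u z) (at z within D)" using u z by (simp add: continuous_on_def)
  have "((\<lambda>w. cmod (u w) * p (\<lambda>s. G w s - G z s) + cmod (u w - u z) * p (G z))
      \<longlongrightarrow> cmod (u z) * 0 + cmod (u z - u z) * p (G z)) (at z within D)"
    using G z uz by (intro tendsto_intros) (auto simp: cont_def)
  then have lim: "((\<lambda>w. cmod (u w) * p (\<lambda>s. G w s - G z s) + cmod (u w - u z) * p (G z)) \<longlongrightarrow> 0) (at z within D)"
    by simp
  have ev: "\<forall>\<^sub>F w in at z within D. w \<in> D"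
    by (simp add: eventually_at_filter)
  show "((\<lambda>w. p (\<lambda>s. u w * G w s - u z * G z s)) \<longlongrightarrow> 0) (at z within D)"
  proof (rule tendsto_sandwich[OF _ _ tendsto_const lim])
    show "\<forall>\<^sub>F w in at z within D. 0 \<le> p (\<lambda>s. u w * G w s - u z * G z s)"
      using ev by eventually_elim (auto intro!: nonneg diff_mem scale_mem mem z)
    show "\<forall>\<^sub>F w in at z within D. p (\<lambda>s. u w * G w s - u z * G z s)
        \<le> cmod (u w) * p (\<lambda>s. G w s - G z s) + cmod (u w - u z) * p (G z)"
      using ev
    proof eventually_elim
      case (elim w)
      have "(\<lambda>s. u w * G w s - u z * G z s) = (\<lambda>s. u w * (G w s - G z s) + (u w - u z) * G z s)"
        by (rule ext) (simp add: algebra_simps)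
      then have "p (\<lambda>s. u w * G w s - u z * G z s) \<le> p (\<lambda>s. u w * (G w s - G z s)) + p (\<lambda>s. (u w - u z) * G z s)"
        using triangle[of "\<lambda>s. u w * (G w s - G z s)" "\<lambda>s. (u w - u z) * G z s"] mem[OF elim] mem[OF z]
        by (simp add: scale_mem diff_mem)
      then show ?case using homogeneous mem[OF elim] mem[OF z] by (simp add: diff_mem)
    qed
  qed
qed

lemma analytic_diff:
  assumes "analytic D G" "analytic D H"
  shows "analytic D (\<lambda>z s. G z s - H z s)"
  unfolding analytic_def
proof
  fix z assume z: "z \<in> D"
  obtain r c where r: "ball z r \<subseteq> D" "expands G c z r" using assms(1) z by (auto simp: analytic_def)
  obtain r' c' where r': "expands H c' z r'" using assms(2) z by (auto simp: analytic_def)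
  have pos: "0 < min r r'" using r r' by (auto dest: expands_radius)
  have "expands (\<lambda>z s. G z s - H z s) (\<lambda>n s. c n s - c' n s) z (min r r')"
    by (intro expands_diff expands_shrink[OF r(2)] expands_shrink[OF r'] pos) auto
  moreover have "ball z (min r r') \<subseteq> D" using r(1) by auto
  ultimately show "\<exists>r c. ball z r \<subseteq> D \<and> expands (\<lambda>z s. G z s - H z s) c z r" by blast
qed

lemma expands_cong: "(\<And>w. w \<in> ball z r \<Longrightarrow> G w = H w) \<Longrightarrow> expands G c z r = expands H c z r"
  by (auto simp: expands_def)

lemma quotient_coeff_mem: "(\<And>n. c n \<in> V) \<Longrightarrow> quotient_coeff d c n \<in> V"
  using scale_mem[of _ "1/d"] by (induction n) (auto simp: diff_mem)

text \<open>The recursive coefficients grow at most like \<open>\<rho> ^ (-n)\<close>, so for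
  \<open>|u|\<close> below \<open>\<rho>\<close> the error term left by
  \<open>quotient_coeff_sum\<close> tends to zero, and the partial sums converge to the quotient
  because those of \<open>G\<close> converge to \<open>G w\<close>.\<close>

lemma expands_quotient:
  assumes G: "expands G c z r" and d: "z \<noteq> a"
  obtains r' where "r' \<le> r" "expands (\<lambda>w s. 1 / (w - a) * G w s) (quotient_coeff (z - a) c) z r'"
proof -
  define d where "d = z - a"
  have d0: "d \<noteq> 0" using d by (simp add: d_def)
  \<comment> \<open>The part \<open>r / 2\<close> gives the coefficient bound for \<open>G\<close>.
    The part \<open>cmod d / 2\<close> makes the recursion for the new coefficients stable and keeps
    \<open>w - a = d + u\<close> away from zero.\<close>
  define \<rho> where "\<rho> = min (r / 2) (cmod d / 2)"
  have rho: "0 < \<rho>" "\<rho> < r" "\<rho> \<le> cmod d / 2" using expands_radius[OF G] d0 by (auto simp: \<rho>_def)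
  obtain K where K: "\<And>n. p (c n) * \<rho> ^ n \<le> K"
    using expands_coeff_bound[OF G rho(1,2)] by blast
  define e where "e = quotient_coeff d c"
  have z: "z \<in> ball z r" using rho by simp
  note mz = expands_mem[OF G z]
  have me: "e n \<in> V" for n unfolding e_def by (intro quotient_coeff_mem mz)
  have K0: "0 \<le> K" using K[of 0] nonneg[OF mz(3)[of 0]] by simp
  \<comment> \<open>The bound reproduces itself: since \<open>\<rho>\<close> is at most
    \<open>|d| / 2\<close>, one step of the recursion gives
    \<open>(K + |d| / 2 * (2 * K / |d|)) / |d| = 2 * K / |d|\<close>.\<close>
  have E: "p (e n) * \<rho> ^ n \<le> 2 * K / cmod d" for n
  proof (induction n)
    case 0
    have "p (e 0) = p (c 0) / cmod d"
      using homogeneous[OF mz(3)[of 0], of "1/d"] by (simp add: e_def norm_divide)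
    also have "\<dots> \<le> 2 * K / cmod d"
      using K[of 0] K0 by (intro divide_right_mono) auto
    finally show ?case by simp
  next
    case (Suc n)
    have "p (e (Suc n)) = p (\<lambda>s. c (Suc n) s - e n s) / cmod d"
      using homogeneous[OF diff_mem[OF mz(3)[of "Suc n"] me[of n]], of "1/d"] by (simp add: e_def norm_divide)
    also have "\<dots> \<le> (p (c (Suc n)) + p (e n)) / cmod d"
      by (intro divide_right_mono triangle_diff mz me) auto
    finally have "p (e (Suc n)) * \<rho> ^ Suc n \<le> (p (c (Suc n)) + p (e n)) / cmod d * \<rho> ^ Suc n"
      using rho by (intro mult_right_mono) auto
    also have "\<dots> = (p (c (Suc n)) * \<rho> ^ Suc n + \<rho> * (p (e n) * \<rho> ^ n)) / cmod d"
      by (simp add: field_simps)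
    also have "\<dots> \<le> (K + cmod d / 2 * (2 * K / cmod d)) / cmod d"
      using K[of "Suc n"] Suc rho nonneg[OF me[of n]]
      by (intro divide_right_mono add_mono mult_mono) auto
    also have "\<dots> = 2 * K / cmod d" using d0 by (simp add: field_simps)
    finally show ?case .
  qed
  have "expands (\<lambda>w s. 1 / (w - a) * G w s) e z \<rho>"
    unfolding expands_def
  proof (intro conjI allI ballI me rho)
    fix w assume w: "w \<in> ball z \<rho>"
    define u where "u = w - z"
    have u: "cmod u < \<rho>" using w by (simp add: u_def dist_norm norm_minus_commute)
    have wr: "w \<in> ball z r" using w rho by auto
    note m = expands_mem[OF G wr]
    have du: "d + u \<noteq> 0"
    proof
      assume "d + u = 0"
      then have "cmod d = cmod u" by (simp add: add_eq_0_iff)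
      then show False using u rho by auto
    qed
    have wa: "w - a = d + u" by (simp add: d_def u_def)
    show "(\<lambda>s. 1 / (w - a) * G w s) \<in> V" by (intro scale_mem m)
    have eq: "(\<lambda>s. (\<Sum>n<Suc N. u ^ n * e n s) - 1 / (w - a) * G w s) =
      (\<lambda>s. 1 / (d + u) * (((\<Sum>n<Suc N. u ^ n * c n s) - G w s) + u ^ Suc N * e N s))" for N
    proof
      fix s
      have "(\<Sum>n<Suc N. u ^ n * e n s) = ((\<Sum>n<Suc N. u ^ n * c n s) + u ^ Suc N * e N s) / (d + u)"
        using quotient_coeff_sum[OF d0, of u c s N] du unfolding e_def by (metis nonzero_mult_div_cancel_left)
      then show "(\<Sum>n<Suc N. u ^ n * e n s) - 1 / (w - a) * G w s =
        1 / (d + u) * (((\<Sum>n<Suc N. u ^ n * c n s) - G w s) + u ^ Suc N * e N s)"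
        unfolding wa by (simp add: diff_divide_distrib add_divide_distrib)
    qed
    have bound: "p (\<lambda>s. (\<Sum>n<Suc N. u ^ n * e n s) - 1 / (w - a) * G w s) \<le>
      1 / cmod (d + u) * (p (\<lambda>s. (\<Sum>n<Suc N. u ^ n * c n s) - G w s) +
         cmod u * (2 * K / cmod d) * (cmod u / \<rho>) ^ N)" for N
    proof -
      have "p (\<lambda>s. (\<Sum>n<Suc N. u ^ n * e n s) - 1 / (w - a) * G w s) =
        1 / cmod (d + u) * p (\<lambda>s. ((\<Sum>n<Suc N. u ^ n * c n s) - G w s) + u ^ Suc N * e N s)"
        unfolding eq
        by (subst homogeneous) (auto intro!: add_mem diff_mem scale_mem me m(2) m(1)[folded u_def] simp: norm_divide simp del: sum.lessThan_Suc power_Suc)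
      also have "\<dots> \<le> 1 / cmod (d + u) * (p (\<lambda>s. (\<Sum>n<Suc N. u ^ n * c n s) - G w s) + p (\<lambda>s. u ^ Suc N * e N s))"
        by (intro mult_left_mono triangle diff_mem scale_mem me m(2) m(1)[folded u_def]) auto
      also have "p (\<lambda>s. u ^ Suc N * e N s) = cmod u * (p (e N) * \<rho> ^ N) * (cmod u / \<rho>) ^ N"
        using rho homogeneous[OF me[of N], of "u ^ Suc N"] by (simp add: norm_mult norm_power power_divide)
      also have "\<dots> \<le> cmod u * (2 * K / cmod d) * (cmod u / \<rho>) ^ N"
        using rho by (intro mult_right_mono mult_left_mono E) auto
      finally show ?thesis by (simp add: divide_right_mono)
    qed
    have "(\<lambda>N. 1 / cmod (d + u) * (p (\<lambda>s. (\<Sum>n<Suc N. u ^ n * c n s) - G w s) +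
         cmod u * (2 * K / cmod d) * (cmod u / \<rho>) ^ N)) \<longlonglongrightarrow> 1 / cmod (d + u) * (0 + cmod u * (2 * K / cmod d) * 0)"
      using LIMSEQ_Suc[OF expands_tendsto[OF G wr]] u rho unfolding u_def[symmetric]
      by (intro tendsto_intros LIMSEQ_realpow_zero) auto
    then have lim: "(\<lambda>N. 1 / cmod (d + u) * (p (\<lambda>s. (\<Sum>n<Suc N. u ^ n * c n s) - G w s) +
         cmod u * (2 * K / cmod d) * (cmod u / \<rho>) ^ N)) \<longlonglongrightarrow> 0" by simp
    have ms: "(\<lambda>s. (\<Sum>n<N. u ^ n * e n s) - 1 / (w - a) * G w s) \<in> V" for N
      by (intro mem_intros me m)
    have "(\<lambda>N. p (\<lambda>s. (\<Sum>n<Suc N. u ^ n * e n s) - 1 / (w - a) * G w s)) \<longlonglongrightarrow> 0"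
      by (rule tendsto_sandwich[OF _ _ tendsto_const lim])
        (intro always_eventually allI nonneg ms bound)+
    then show "(\<lambda>N. p (\<lambda>s. (\<Sum>n<N. (w - z) ^ n * e n s) - 1 / (w - a) * G w s)) \<longlonglongrightarrow> 0"
      unfolding u_def[symmetric] by (rule LIMSEQ_imp_Suc)
  qed
  then show thesis using that[of \<rho>] rho by (simp add: e_def d_def)
qed

text \<open>Since \<open>G a\<close> has seminorm zero, so has \<open>c 0\<close>. Dropping the
  constant term and dividing by \<open>w - a\<close> shifts the coefficients by one place, and the
  filled-in value \<open>c 1\<close> is exactly the new constant term.\<close>

lemma expands_removed:
  assumes G: "expands G c a r" and zero: "p (G a) = 0"
  shows "expands (removed a (c 1) G) (\<lambda>n. c (Suc n)) a r"
  unfolding expands_def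
proof (intro conjI allI ballI)
  show "0 < r" using G by (rule expands_radius)
  show "c (Suc n) \<in> V" for n using G by (simp add: expands_def)
  fix w assume w: "w \<in> ball a r"
  note m = expands_mem[OF G w]
  have a: "a \<in> ball a r" using \<open>0 < r\<close> by simp
  note ma = expands_mem[OF G a]
  show mR: "removed a (c 1) G w \<in> V" using scale_mem[OF m(2)] m(3)[of 1] unfolding removed_def by presburger
  have c0: "p (c 0) = 0"
    using seminorm_le_diff[OF ma(3)[of 0] ma(2)] expands_center[OF G] zero nonneg[OF ma(3)[of 0]] by simp
  show "(\<lambda>N. p (\<lambda>s. (\<Sum>n<N. (w - a) ^ n * c (Suc n) s) - removed a (c 1) G w s)) \<longlonglongrightarrow> 0"
  proof (cases "w = a")
    case True
    \<comment> \<open>For \<open>N = 0\<close> the sum is empty and does not yield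
      \<open>c 1\<close>; hence the passage to \<open>Suc N\<close>.\<close>
    have "(\<lambda>s. (\<Sum>n<Suc N. (w - a) ^ n * c (Suc n) s) - removed a (c 1) G w s) = (\<lambda>s. 0)" for N
      by (rule ext, subst sum.lessThan_Suc_shift) (simp add: True removed_def)
    then have "(\<lambda>N. p (\<lambda>s. (\<Sum>n<Suc N. (w - a) ^ n * c (Suc n) s) - removed a (c 1) G w s)) \<longlonglongrightarrow> 0"
      by (simp only: seminorm_zero tendsto_const)
    then show ?thesis by (rule LIMSEQ_imp_Suc)
  next
    case False
    define u where "u = w - a"
    have u: "u \<noteq> 0" using False by (simp add: u_def)
    note m = m[folded u_def]
    have eq: "(\<lambda>s. (\<Sum>n<N. u ^ n * c (Suc n) s) - removed a (c 1) G w s) =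
      (\<lambda>s. 1 / u * (((\<Sum>n<Suc N. u ^ n * c n s) - G w s) - c 0 s))" for N
    proof
      fix s
      have "(\<Sum>n<Suc N. u ^ n * c n s) = c 0 s + u * (\<Sum>n<N. u ^ n * c (Suc n) s)"
        by (subst sum.lessThan_Suc_shift) (simp add: sum_distrib_left mult.assoc)
      then have "1 / u * (((\<Sum>n<Suc N. u ^ n * c n s) - G w s) - c 0 s) =
        1 / u * (u * (\<Sum>n<N. u ^ n * c (Suc n) s) - G w s)" by simp
      also have "\<dots> = (\<Sum>n<N. u ^ n * c (Suc n) s) - 1 / u * G w s"
        using u by (simp add: diff_divide_distrib)
      also have "1 / u * G w s = removed a (c 1) G w s"
        using False by (simp add: removed_def u_def)
      finally show "(\<Sum>n<N. u ^ n * c (Suc n) s) - removed a (c 1) G w s =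
        1 / u * (((\<Sum>n<Suc N. u ^ n * c n s) - G w s) - c 0 s)" by (rule sym)
    qed
    have le: "p (\<lambda>s. (\<Sum>n<N. u ^ n * c (Suc n) s) - removed a (c 1) G w s) \<le>
      1 / cmod u * p (\<lambda>s. (\<Sum>n<Suc N. u ^ n * c n s) - G w s)" for N
    proof -
      have "p (\<lambda>s. (\<Sum>n<N. u ^ n * c (Suc n) s) - removed a (c 1) G w s) =
        1 / cmod u * p (\<lambda>s. ((\<Sum>n<Suc N. u ^ n * c n s) - G w s) - c 0 s)"
        unfolding eq by (subst homogeneous) (intro diff_mem m, simp add: norm_divide)
      also have "\<dots> \<le> 1 / cmod u * (p (\<lambda>s. (\<Sum>n<Suc N. u ^ n * c n s) - G w s) + p (c 0))"
        by (intro mult_left_mono triangle_diff diff_mem m) auto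
      finally show ?thesis using c0 by simp
    qed
    have nn: "0 \<le> p (\<lambda>s. (\<Sum>n<N. u ^ n * c (Suc n) s) - removed a (c 1) G w s)" for N
      by (intro nonneg diff_mem sum_mem scale_mem m mR)
    have lim: "(\<lambda>N. 1 / cmod u * p (\<lambda>s. (\<Sum>n<Suc N. u ^ n * c n s) - G w s)) \<longlonglongrightarrow> 1 / cmod u * 0"
      unfolding u_def by (rule tendsto_mult_left[OF LIMSEQ_Suc[OF expands_tendsto[OF G w]]])
    show ?thesis
      unfolding u_def[symmetric]
      by (rule tendsto_sandwich[OF _ _ tendsto_const lim[unfolded mult_zero_right]])
        (intro always_eventually allI nn le)+
  qed
qed

lemma analytic_removed:
  assumes G: "analytic D G" and a: "expands G c a r" "ball a r \<subseteq> D" and zero: "p (G a) = 0"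
  shows "analytic D (removed a (c 1) G)"
  unfolding analytic_def
proof
  fix z assume z: "z \<in> D"
  show "\<exists>r e. ball z r \<subseteq> D \<and> expands (removed a (c 1) G) e z r"
  proof (cases "z = a")
    case True
    then show ?thesis using expands_removed[OF a(1) zero] a(2) by blast
  next
    case False
    obtain r1 c1 where r1: "ball z r1 \<subseteq> D" "expands G c1 z r1" using G z by (auto simp: analytic_def)
    obtain r2 where r2: "r2 \<le> r1" "expands (\<lambda>w s. 1 / (w - a) * G w s) (quotient_coeff (z - a) c1) z r2"
      using expands_quotient[OF r1(2) False] by blast
    \<comment> \<open>Keeping \<open>a\<close> outside the ball makes the removed function agree
      with the plain quotient on all of it.\<close>
    define r3 where "r3 = min r2 (dist z a)"
    have "expands (\<lambda>w s. 1 / (w - a) * G w s) (quotient_coeff (z - a) c1) z r3"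
      using expands_radius[OF r2(2)] False by (intro expands_shrink[OF r2(2)]) (auto simp: r3_def)
    then have "expands (removed a (c 1) G) (quotient_coeff (z - a) c1) z r3"
      by (subst expands_cong[of z r3 _ "\<lambda>w s. 1 / (w - a) * G w s"]) (auto simp: removed_def r3_def)
    moreover have "ball z r3 \<subseteq> D" using r1(1) r2(1) by (auto simp: r3_def)
    ultimately show ?thesis by blast
  qed
qed

text \<open>At \<open>a\<close> continuity is the differentiability of \<open>G\<close> with
  derivative \<open>c 1\<close>. The difference quotient contains \<open>G a\<close>, which is only
  of seminorm zero and not literally zero, so it is discarded through \<open>seminorm_cong\<close>.
  Away from \<open>a\<close> the factor \<open>1 / (z - a)\<close> is continuous.\<close>

lemma cont_removed:
  assumes mem: "\<And>z. z \<in> D \<Longrightarrow> G z \<in> V" and G: "cont D G" and a: "expands G c a r"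
    and zero: "p (G a) = 0"
  shows "cont D (removed a (c 1) G)"
  unfolding cont_def
proof
  have "a \<in> ball a r" using a by (simp add: expands_def)
  then have aV: "G a \<in> V" and c1: "c 1 \<in> V" using a by (auto simp: expands_def)
  fix z assume z: "z \<in> D"
  show "((\<lambda>w. p (\<lambda>s. removed a (c 1) G w s - removed a (c 1) G z s)) \<longlongrightarrow> 0) (at z within D)"
  proof (cases "z = a")
    case True
    have "((\<lambda>w. p (\<lambda>s. 1 / (w - a) * (G w s - G a s) - c 1 s)) \<longlongrightarrow> 0) (at a within D)"
      by (rule tendsto_within_subset[OF expands_derivative[OF a]]) simp
    moreover have "\<forall>\<^sub>F w in at a within D. w \<in> D \<and> w \<noteq> a"
      by (simp add: eventually_at_filter)
    then have "\<forall>\<^sub>F w in at a within D. p (\<lambda>s. 1 / (w - a) * (G w s - G a s) - c 1 s) =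
        p (\<lambda>s. removed a (c 1) G w s - removed a (c 1) G z s)"
    proof eventually_elim
      case (elim w)
      have "(\<lambda>s. (1 / (w - a) * (G w s - G a s) - c 1 s) - (1 / (w - a) * G w s - c 1 s)) =
          (\<lambda>s. (- 1 / (w - a)) * G a s)"
        using elim by (auto simp: diff_divide_distrib)
      then have "p (\<lambda>s. (1 / (w - a) * (G w s - G a s) - c 1 s) - (1 / (w - a) * G w s - c 1 s)) = 0"
        using homogeneous[OF aV, of "- 1 / (w - a)"] zero by simp
      then have "p (\<lambda>s. 1 / (w - a) * (G w s - G a s) - c 1 s) = p (\<lambda>s. 1 / (w - a) * G w s - c 1 s)"
        using mem[of w] elim by (intro seminorm_cong diff_mem scale_mem aV c1) simp_all
      then show ?case using elim by (simp add: removed_def True)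
    qed
    ultimately show ?thesis unfolding True by (rule Lim_transform_eventually)
  next
    case False
    have "cont (D - {a}) (\<lambda>z s. 1 / (z - a) * G z s)"
    proof (rule cont_scale)
      show "cont (D - {a}) G" using G by (auto simp: cont_def intro: tendsto_within_subset)
    qed (auto intro!: continuous_intros mem)
    then have *: "((\<lambda>w. p (\<lambda>s. 1 / (w - a) * G w s - 1 / (z - a) * G z s)) \<longlongrightarrow> 0) (at z within (D - {a}))"
      using z False by (auto simp: cont_def)
    have "at z within (D - {a}) = at z within D"
      by (rule at_within_nhd[of _ "- {a}"]) (use False in auto)
    with * have "((\<lambda>w. p (\<lambda>s. 1 / (w - a) * G w s - 1 / (z - a) * G z s)) \<longlongrightarrow> 0) (at z within D)"
      by simp
    moreover have "\<forall>\<^sub>F w in at z within D. w \<in> - {a}"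
      using False by (intro topological_tendstoD[OF tendsto_ident_at]) auto
    then have "\<forall>\<^sub>F w in at z within D. p (\<lambda>s. 1 / (w - a) * G w s - 1 / (z - a) * G z s) =
        p (\<lambda>s. removed a (c 1) G w s - removed a (c 1) G z s)"
      by eventually_elim (use False in \<open>auto simp: removed_def\<close>)
    ultimately show ?thesis by (rule Lim_transform_eventually)
  qed
qed

text \<open>Continuity at \<open>a\<close> gives a radius \<open>\<delta>\<close> within which the
  value differs from \<open>c 1\<close> by less than 1 in seminorm; outside it
  \<open>1 / |z - a|\<close> is at most \<open>1 / \<delta>\<close>.\<close>

lemma bounded_removed:
  assumes mem: "\<And>z. z \<in> D \<Longrightarrow> G z \<in> V" and G: "cont D G" and a: "expands G c a r"
    and zero: "p (G a) = 0" and aD: "a \<in> D" and K: "\<And>z. z \<in> D \<Longrightarrow> p (G z) \<le> K"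
  shows "\<exists>K. \<forall>z\<in>D. p (removed a (c 1) G z) \<le> K"
proof -
  have c1: "c 1 \<in> V" using a by (simp add: expands_def)
  have mR: "removed a (c 1) G z \<in> V" if "z \<in> D" for z
    using scale_mem[OF mem[OF that]] c1 unfolding removed_def by presburger
  have "((\<lambda>w. p (\<lambda>s. removed a (c 1) G w s - removed a (c 1) G a s)) \<longlongrightarrow> 0) (at a within D)"
    using cont_removed[OF mem G a zero] aD by (auto simp: cont_def)
  then have "\<forall>\<^sub>F w in at a within D. p (\<lambda>s. removed a (c 1) G w s - removed a (c 1) G a s) < 1"
    by (rule order_tendstoD) simp
  then obtain \<delta> where \<delta>: "0 < \<delta>" "\<And>w. w \<in> D \<Longrightarrow> w \<noteq> a \<Longrightarrow> dist w a < \<delta> \<Longrightarrow>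
      p (\<lambda>s. removed a (c 1) G w s - removed a (c 1) G a s) < 1"
    by (auto simp: eventually_at)
  have "p (removed a (c 1) G z) \<le> max (p (c 1) + 1) (K / \<delta>)" if z: "z \<in> D" for z
  proof (cases "z = a")
    case True then show ?thesis by (simp add: removed_def)
  next
    case False
    show ?thesis
    proof (cases "dist z a < \<delta>")
      case True
      then have "p (removed a (c 1) G z) \<le> p (removed a (c 1) G a) + 1"
        using seminorm_le_diff[OF mR[OF z] mR[OF aD]] \<delta>(2)[OF z False] by simp
      then show ?thesis by (simp add: removed_def)
    next
      case far: False
      have "p (removed a (c 1) G z) = p (G z) / cmod (z - a)"
        using False homogeneous[OF mem[OF z], of "1 / (z - a)"] by (simp add: removed_def norm_divide)
      also have "\<dots> \<le> K / \<delta>"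
        using far \<delta>(1) K[OF z] nonneg[OF mem[OF z]] by (intro frac_le) (auto simp: dist_norm)
      finally show ?thesis by simp
    qed
  qed
  then show ?thesis by blast
qed

end

section \<open>Weighted composition operators on vector-valued analytic functions\<close>

definition wcomp :: "('s \<Rightarrow> complex) \<Rightarrow> ('s \<Rightarrow> 's) \<Rightarrow> ('s \<Rightarrow> complex) \<Rightarrow> 's \<Rightarrow> complex" where
  "wcomp \<epsilon> \<tau> f = (\<lambda>s. \<epsilon> s * f (\<tau> s))"

context function_seminorm begin

text \<open>Weighted composition is linear pointwise, so it passes through the partial sums and acts
  on each coefficient. Contractivity is all that convergence requires, and it is the form in which
  the estimate is obtained on the sum space.\<close>

lemma expands_wcomp:
  assumes T: "\<And>f. f \<in> V \<Longrightarrow> wcomp \<epsilon> \<tau> f \<in> V" "\<And>f. f \<in> V \<Longrightarrow> p (wcomp \<epsilon> \<tau> f) \<le> p f"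
    and G: "expands G c z r"
  shows "expands (\<lambda>w. wcomp \<epsilon> \<tau> (G w)) (\<lambda>n. wcomp \<epsilon> \<tau> (c n)) z r"
  unfolding expands_def
proof (intro conjI allI ballI)
  show "0 < r" using G by (rule expands_radius)
  show "wcomp \<epsilon> \<tau> (c n) \<in> V" for n using G by (simp add: expands_def T)
  fix w assume w: "w \<in> ball z r"
  note m = expands_mem[OF G w]
  show "wcomp \<epsilon> \<tau> (G w) \<in> V" by (intro T m)
  have md: "(\<lambda>s. (\<Sum>n<N. (w - z) ^ n * c n s) - G w s) \<in> V" for N
    by (intro diff_mem m)
  have eq: "(\<lambda>s. (\<Sum>n<N. (w - z) ^ n * wcomp \<epsilon> \<tau> (c n) s) - wcomp \<epsilon> \<tau> (G w) s) =
    wcomp \<epsilon> \<tau> (\<lambda>s. (\<Sum>n<N. (w - z) ^ n * c n s) - G w s)" for N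
    by (auto simp: wcomp_def right_diff_distrib sum_distrib_left mult.left_commute)
  show "(\<lambda>N. p (\<lambda>s. (\<Sum>n<N. (w - z) ^ n * wcomp \<epsilon> \<tau> (c n) s) - wcomp \<epsilon> \<tau> (G w) s)) \<longlonglongrightarrow> 0"
    unfolding eq
    by (rule tendsto_sandwich[OF _ _ tendsto_const expands_tendsto[OF G w]])
      (intro always_eventually allI nonneg T md)+
qed

lemma analytic_wcomp:
  assumes "\<And>f. f \<in> V \<Longrightarrow> wcomp \<epsilon> \<tau> f \<in> V" "\<And>f. f \<in> V \<Longrightarrow> p (wcomp \<epsilon> \<tau> f) \<le> p f"
    and "analytic D G"
  shows "analytic D (\<lambda>w. wcomp \<epsilon> \<tau> (G w))"
  unfolding analytic_def
proof
  fix z assume "z \<in> D"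
  then obtain r c where "ball z r \<subseteq> D" "expands G c z r" using assms(3) by (auto simp: analytic_def)
  then show "\<exists>r c. ball z r \<subseteq> D \<and> expands (\<lambda>w. wcomp \<epsilon> \<tau> (G w)) c z r"
    using expands_wcomp[OF assms(1,2)] by (intro exI conjI)
qed

lemma cont_wcomp:
  assumes T: "\<And>f. f \<in> V \<Longrightarrow> wcomp \<epsilon> \<tau> f \<in> V" "\<And>f. f \<in> V \<Longrightarrow> p (wcomp \<epsilon> \<tau> f) \<le> p f"
    and mem: "\<And>z. z \<in> D \<Longrightarrow> G z \<in> V" and G: "cont D G"
  shows "cont D (\<lambda>w. wcomp \<epsilon> \<tau> (G w))"
  unfolding cont_def
proof
  fix z assume z: "z \<in> D"
  have lim: "((\<lambda>w. p (\<lambda>s. G w s - G z s)) \<longlongrightarrow> 0) (at z within D)" using G z by (simp add: cont_def)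
  have ev: "\<forall>\<^sub>F w in at z within D. w \<in> D"
    by (simp add: eventually_at_filter)
  have eq: "(\<lambda>s. wcomp \<epsilon> \<tau> (G w) s - wcomp \<epsilon> \<tau> (G z) s) = wcomp \<epsilon> \<tau> (\<lambda>s. G w s - G z s)" for w
    by (auto simp: wcomp_def right_diff_distrib)
  show "((\<lambda>w. p (\<lambda>s. wcomp \<epsilon> \<tau> (G w) s - wcomp \<epsilon> \<tau> (G z) s)) \<longlongrightarrow> 0) (at z within D)"
    unfolding eq
  proof (rule tendsto_sandwich[OF _ _ tendsto_const lim])
    show "\<forall>\<^sub>F w in at z within D. 0 \<le> p (wcomp \<epsilon> \<tau> (\<lambda>s. G w s - G z s))"
      using ev by eventually_elim (intro nonneg T diff_mem mem z)
    show "\<forall>\<^sub>F w in at z within D. p (wcomp \<epsilon> \<tau> (\<lambda>s. G w s - G z s)) \<le> p (\<lambda>s. G w s - G z s)"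
      using ev by eventually_elim (intro T diff_mem mem z)
  qed
qed

end

section \<open>The sum of a compatible couple\<close>

text \<open>Norms are transported to representatives, so that identities between classes become pointwise
  identities between functions.\<close>

definition fmem :: "'s measure \<Rightarrow> 's fclass nspace \<Rightarrow> ('s \<Rightarrow> complex) set" where
  "fmem M X = {f \<in> borel_measurable M. cls M f \<in> carr X}"

definition fnrm :: "'s measure \<Rightarrow> 's fclass nspace \<Rightarrow> ('s \<Rightarrow> complex) \<Rightarrow> real" where
  "fnrm M X f = nrm X (cls M f)"

lemma normed_subspaceD:
  assumes "normed_subspace M X"
  shows "F \<in> carr X \<Longrightarrow> F \<in> L0 M" "L0_zero M \<in> carr X"
    "F \<in> carr X \<Longrightarrow> G \<in> carr X \<Longrightarrow> L0_add M F G \<in> carr X"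
    "F \<in> carr X \<Longrightarrow> L0_scale M c F \<in> carr X"
    "F \<in> carr X \<Longrightarrow> 0 \<le> nrm X F"
    "F \<in> carr X \<Longrightarrow> nrm X F = 0 \<longleftrightarrow> F = L0_zero M"
    "F \<in> carr X \<Longrightarrow> nrm X (L0_scale M c F) = cmod c * nrm X F"
    "F \<in> carr X \<Longrightarrow> G \<in> carr X \<Longrightarrow> nrm X (L0_add M F G) \<le> nrm X F + nrm X G"
  using assms by (simp_all add: normed_subspace_def subset_iff)

lemma function_seminorm_fnrm:
  assumes "normed_subspace M X"
  shows "function_seminorm (fmem M X) (fnrm M X)"
proof
  note d = normed_subspaceD[OF assms]
  show "(\<lambda>s. 0) \<in> fmem M X" using d(2) by (simp add: fmem_def L0_zero_def)
  fix f g c assume f: "f \<in> fmem M X"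
  then have [measurable]: "f \<in> borel_measurable M" and fc: "cls M f \<in> carr X" by (auto simp: fmem_def)
  show "(\<lambda>s. c * f s) \<in> fmem M X" using d(4)[OF fc, of c] by (simp add: fmem_def L0_cls_simps)
  show "0 \<le> fnrm M X f" using d(5)[OF fc] by (simp add: fnrm_def)
  show "fnrm M X (\<lambda>s. c * f s) = cmod c * fnrm M X f" using d(7)[OF fc, of c] by (simp add: fnrm_def L0_cls_simps)
  assume g: "g \<in> fmem M X"
  then have [measurable]: "g \<in> borel_measurable M" and gc: "cls M g \<in> carr X" by (auto simp: fmem_def)
  show "(\<lambda>s. f s + g s) \<in> fmem M X" using d(3)[OF fc gc] by (simp add: fmem_def L0_cls_simps)
  show "fnrm M X (\<lambda>s. f s + g s) \<le> fnrm M X f + fnrm M X g"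
    using d(8)[OF fc gc] by (simp add: fnrm_def L0_cls_simps)
qed

text \<open>Where \<open>|f|\<close> is at least \<open>2 * \<epsilon>\<close>, one of the two
  summands has modulus at least \<open>\<epsilon>\<close>. On a set of finite measure this happens
  on a set whose measure is bounded by a null sequence, hence on a null set. Countably many sets of
  finite measure and the thresholds \<open>2 / (k + 1)\<close> then cover the whole space. The
  purpose is definiteness of the sum norm.\<close>

lemma tendsto_L0_zero_sum:
  fixes M :: "'s measure"
  assumes "sigma_finite_measure M"
    and u: "\<And>n. u n \<in> L0 M" "tendsto_L0 M u (L0_zero M)"
    and v: "\<And>n. v n \<in> L0 M" "tendsto_L0 M v (L0_zero M)"
    and F: "\<And>n. F = L0_add M (u n) (v n)"
  shows "F = L0_zero M"
proof -
  interpret sigma_finite_measure M by fact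
  define f where "f = rep F"
  note [measurable] = rep_measurable[OF u(1)] rep_measurable[OF v(1)]
  have FL: "F \<in> L0 M" by (subst F[of 0]) (simp add: L0_add_def cls_in_L0)
  note [measurable] = rep_measurable[OF FL, folded f_def]
  \<comment> \<open>\<open>tendsto_L0\<close> compares with the chosen representative of the zero
    class, which vanishes only almost everywhere.\<close>
  define o' where "o' = rep (L0_zero M)"
  have o: "o' \<in> borel_measurable M" "AE s in M. o' s = 0"
    unfolding o'_def L0_zero_def by (intro rep_cls_measurable rep_cls_AE; simp)+
  note [measurable] = o(1)
  have sum: "AE s in M. f s = rep (u n) s + rep (v n) s" for n
    unfolding f_def by (subst F[of n]) (auto simp: L0_add_def intro!: rep_cls_AE)
  have null: "AE s in M. s \<in> A \<longrightarrow> cmod (f s) < 2 * \<epsilon>" if A: "A \<in> fmeasurable M" and \<epsilon>: "0 < \<epsilon>" for A \<epsilon>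
  proof -
    note [measurable] = fmeasurableD[OF A]
    define U where "U n = {s \<in> A. \<epsilon> \<le> cmod (rep (u n) s - o' s)}" for n
    define W where "W n = {s \<in> A. \<epsilon> \<le> cmod (rep (v n) s - o' s)}" for n
    define E where "E = {s \<in> A. 2 * \<epsilon> \<le> cmod (f s)}"
    have A_sp: "{s \<in> A. P s} = {s \<in> space M. s \<in> A \<and> P s}" for P
      using sets.sets_into_space[OF fmeasurableD[OF A]] by auto
    have U: "U n \<in> fmeasurable M" for n
      by (rule fmeasurableI2[OF A]) (auto simp: U_def A_sp)
    have W: "W n \<in> fmeasurable M" for n
      by (rule fmeasurableI2[OF A]) (auto simp: W_def A_sp)
    have E: "E \<in> fmeasurable M"
      by (rule fmeasurableI2[OF A]) (auto simp: E_def A_sp)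
    have "measure M E \<le> measure M (U n) + measure M (W n)" for n
    proof -
      have "emeasure M E \<le> emeasure M (U n \<union> W n)"
      proof (rule emeasure_mono_AE)
        show "AE s in M. s \<in> E \<longrightarrow> s \<in> U n \<union> W n"
          using sum[of n] o(2)
        proof eventually_elim
          case (elim s)
          show ?case
          proof
            assume s: "s \<in> E"
            have "2 * \<epsilon> \<le> cmod (rep (u n) s) + cmod (rep (v n) s)"
              using s elim norm_triangle_ineq[of "rep (u n) s" "rep (v n) s"] by (auto simp: E_def)
            then have "\<epsilon> \<le> cmod (rep (u n) s) \<or> \<epsilon> \<le> cmod (rep (v n) s)" by linarith
            then show "s \<in> U n \<union> W n" using s elim by (auto simp: E_def U_def W_def)
          qed
        qed
        show "U n \<union> W n \<in> sets M" using U W by (auto dest: fmeasurableD)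
      qed
      then have "measure M E \<le> measure M (U n \<union> W n)"
        using fmeasurable.Un[OF U[of n] W[of n]] E by (simp add: emeasure_eq_measure2)
      also have "\<dots> \<le> measure M (U n) + measure M (W n)"
        using U[of n] W[of n] by (intro measure_Un_le) (auto dest: fmeasurableD)
      finally show ?thesis .
    qed
    moreover have "(\<lambda>n. measure M (U n) + measure M (W n)) \<longlonglongrightarrow> 0 + 0"
      using u(2) v(2) A \<epsilon> unfolding U_def W_def tendsto_L0_def o'_def by (intro tendsto_add) auto
    ultimately have "measure M E \<le> 0 + 0"
      by (intro LIMSEQ_le_const[of _ "0 + 0"]) auto
    then have "measure M E = 0" using measure_nonneg[of M E] by linarith
    then have "E \<in> null_sets M"
      using E by (intro null_setsI) (auto simp: emeasure_eq_measure2 dest: fmeasurableD)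
    then show ?thesis by (rule AE_I'[of E]) (auto simp: E_def)
  qed
  obtain A :: "nat \<Rightarrow> 's set" where A: "range A \<subseteq> sets M" "(\<Union>i. A i) = space M" "\<And>i. emeasure M (A i) \<noteq> \<infinity>"
    using sigma_finite by blast
  have "AE s in M. \<forall>i k. s \<in> A i \<longrightarrow> cmod (f s) < 2 * (1 / real (Suc k))"
    unfolding AE_all_countable
    using A by (intro allI null) (auto intro!: fmeasurableI simp: less_top)
  then have "AE s in M. f s = 0"
    using AE_space
  proof eventually_elim
    case (elim s)
    then obtain i where "s \<in> A i" using A(2) by auto
    then have "cmod (f s) / 2 < inverse (real (Suc k))" for k
      using elim by (auto simp: field_simps)
    then have "\<not> 0 < cmod (f s) / 2"
      using reals_Archimedean[of "cmod (f s) / 2"] by (meson less_asym)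
    then show ?case by simp
  qed
  then have "cls M f = cls M (\<lambda>s. 0)" by (subst cls_eq_iff) auto
  then show ?thesis unfolding f_def cls_rep[OF FL] L0_zero_def .
qed

context
  fixes M :: "'s measure" and X0 X1 :: "'s fclass nspace"
  assumes X0: "normed_subspace M X0" and X1: "normed_subspace M X1"
begin

lemma sum_norm_values_nonneg:
  assumes "x \<in> {nrm X0 F0 + nrm X1 F1 | F0 F1. F0 \<in> carr X0 \<and> F1 \<in> carr X1 \<and> F = L0_add M F0 F1}"
  shows "0 \<le> x"
proof -
  obtain F0 F1 where "x = nrm X0 F0 + nrm X1 F1" "F0 \<in> carr X0" "F1 \<in> carr X1"
    using assms by blast
  then show ?thesis using normed_subspaceD(5)[OF X0, of F0] normed_subspaceD(5)[OF X1, of F1] by simp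
qed

lemma sum_norm_le:
  assumes "F0 \<in> carr X0" "F1 \<in> carr X1"
  shows "nrm (sum_space M X0 X1) (L0_add M F0 F1) \<le> nrm X0 F0 + nrm X1 F1"
  unfolding sum_space_def nspace.simps
proof (rule cInf_lower)
  show "bdd_below {nrm X0 G0 + nrm X1 G1 | G0 G1. G0 \<in> carr X0 \<and> G1 \<in> carr X1 \<and> L0_add M F0 F1 = L0_add M G0 G1}"
    by (rule bdd_belowI, rule sum_norm_values_nonneg)
  show "nrm X0 F0 + nrm X1 F1 \<in> {nrm X0 G0 + nrm X1 G1 | G0 G1. G0 \<in> carr X0 \<and> G1 \<in> carr X1 \<and> L0_add M F0 F1 = L0_add M G0 G1}"
    by (rule CollectI, rule exI[of _ F0], rule exI[of _ F1]) (simp add: assms)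
qed

lemma sum_norm_approx:
  assumes "F \<in> carr (sum_space M X0 X1)" "0 < e"
  obtains F0 F1 where "F0 \<in> carr X0" "F1 \<in> carr X1" "F = L0_add M F0 F1"
    "nrm X0 F0 + nrm X1 F1 < nrm (sum_space M X0 X1) F + e"
proof -
  let ?S = "{nrm X0 F0 + nrm X1 F1 | F0 F1. F0 \<in> carr X0 \<and> F1 \<in> carr X1 \<and> F = L0_add M F0 F1}"
  have "?S \<noteq> {}" using assms(1) by (auto simp: sum_space_def)
  moreover have "Inf ?S < nrm (sum_space M X0 X1) F + e"
    using assms(2) by (simp add: sum_space_def)
  ultimately have "\<exists>x\<in>?S. x < nrm (sum_space M X0 X1) F + e"
    by (rule cInf_lessD)
  then obtain F0 F1 where "F0 \<in> carr X0" "F1 \<in> carr X1" "F = L0_add M F0 F1"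
    "nrm X0 F0 + nrm X1 F1 < nrm (sum_space M X0 X1) F + e"
    by blast
  then show ?thesis by (rule that)
qed

lemma sum_spaceE:
  assumes "F \<in> carr (sum_space M X0 X1)"
  obtains F0 F1 where "F0 \<in> carr X0" "F1 \<in> carr X1" "F = L0_add M F0 F1"
  using assms by (auto simp: sum_space_def)

lemma sum_spaceI: "F0 \<in> carr X0 \<Longrightarrow> F1 \<in> carr X1 \<Longrightarrow> L0_add M F0 F1 \<in> carr (sum_space M X0 X1)"
  by (auto simp: sum_space_def)

lemma sum_space_L0: "F \<in> carr (sum_space M X0 X1) \<Longrightarrow> F \<in> L0 M"
  using normed_subspaceD(1)[OF X0] normed_subspaceD(1)[OF X1]
  by (elim sum_spaceE) (simp, unfold L0_add_def, intro cls_in_L0 borel_measurable_add rep_measurable)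

lemma sum_norm_nonneg:
  assumes "F \<in> carr (sum_space M X0 X1)"
  shows "0 \<le> nrm (sum_space M X0 X1) F"
  unfolding sum_space_def nspace.simps
proof (rule cInf_greatest)
  show "{nrm X0 F0 + nrm X1 F1 | F0 F1. F0 \<in> carr X0 \<and> F1 \<in> carr X1 \<and> F = L0_add M F0 F1} \<noteq> {}"
    using assms by (auto simp: sum_space_def)
qed (rule sum_norm_values_nonneg)

lemma L0_add_add_commute:
  assumes "F \<in> L0 M" "G \<in> L0 M" "H \<in> L0 M" "K \<in> L0 M"
  shows "L0_add M (L0_add M F G) (L0_add M H K) = L0_add M (L0_add M F H) (L0_add M G K)"
  using assms by (elim L0E) (simp add: L0_cls_simps algebra_simps)

lemma L0_scale_add:
  assumes "F \<in> L0 M" "G \<in> L0 M"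
  shows "L0_scale M c (L0_add M F G) = L0_add M (L0_scale M c F) (L0_scale M c G)"
  using assms by (elim L0E) (simp add: L0_cls_simps algebra_simps)

text \<open>Scaling a nearly optimal decomposition gives one inequality. The reverse one for nonzero
  \<open>c\<close> follows later by scaling back with \<open>1 / c\<close>.\<close>

lemma sum_space_scale:
  assumes "F \<in> carr (sum_space M X0 X1)"
  shows "L0_scale M c F \<in> carr (sum_space M X0 X1)"
    and "nrm (sum_space M X0 X1) (L0_scale M c F) \<le> cmod c * nrm (sum_space M X0 X1) F"
proof -
  note d0 = normed_subspaceD[OF X0] and d1 = normed_subspaceD[OF X1]
  show "L0_scale M c F \<in> carr (sum_space M X0 X1)"
    using assms by (rule sum_spaceE) (simp add: L0_scale_add d0(1,4) d1(1,4) sum_spaceI)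
  have le: "nrm (sum_space M X0 X1) (L0_scale M c F) \<le> cmod c * nrm (sum_space M X0 X1) F + cmod c * e"
    if e: "0 < e" for e
  proof -
    obtain F0 F1 where F: "F0 \<in> carr X0" "F1 \<in> carr X1" "F = L0_add M F0 F1"
      and less: "nrm X0 F0 + nrm X1 F1 < nrm (sum_space M X0 X1) F + e"
      using sum_norm_approx[OF assms e] .
    have "nrm (sum_space M X0 X1) (L0_scale M c F) \<le> nrm X0 (L0_scale M c F0) + nrm X1 (L0_scale M c F1)"
      using F by (simp add: L0_scale_add d0(1,4) d1(1,4) sum_norm_le)
    also have "\<dots> = cmod c * (nrm X0 F0 + nrm X1 F1)"
      using F by (simp add: d0(7) d1(7) algebra_simps)
    also have "\<dots> \<le> cmod c * (nrm (sum_space M X0 X1) F + e)"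
      using less by (intro mult_left_mono) auto
    finally show ?thesis by (simp add: algebra_simps)
  qed
  show "nrm (sum_space M X0 X1) (L0_scale M c F) \<le> cmod c * nrm (sum_space M X0 X1) F"
  proof (cases "c = 0")
    case True then show ?thesis using le[of 1] by simp
  next
    case False
    show ?thesis
    proof (rule field_le_epsilon)
      fix e :: real assume "0 < e"
      then show "nrm (sum_space M X0 X1) (L0_scale M c F) \<le> cmod c * nrm (sum_space M X0 X1) F + e"
        using le[of "e / cmod c"] False by simp
    qed
  qed
qed

text \<open>The delicate axiom is definiteness. Norm zero yields decompositions of \<open>F\<close>
  whose two parts have norms tending to zero; by the continuous embeddings both parts tend to zero
  in measure on sets of finite measure, and \<open>tendsto_L0_zero_sum\<close> forces
  \<open>F\<close> to be zero. Without it the derivative in the sum space would not be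
  unique.\<close>

lemma normed_subspace_sum_space:
  assumes sf: "sigma_finite_measure M" and emb: "continuously_embedded M X0" "continuously_embedded M X1"
  shows "normed_subspace M (sum_space M X0 X1)"
proof -
  let ?X = "sum_space M X0 X1"
  note d0 = normed_subspaceD[OF X0] and d1 = normed_subspaceD[OF X1]
  have zz: "L0_add M (L0_zero M) (L0_zero M) = L0_zero M"
    by (simp add: L0_cls_simps)
  have zero: "L0_zero M \<in> carr ?X" using sum_spaceI[OF d0(2) d1(2)] by (simp add: zz)
  have nz: "nrm ?X (L0_zero M) = 0"
    using sum_norm_le[OF d0(2) d1(2)] sum_norm_nonneg[OF zero] d0(6)[OF d0(2)] d1(6)[OF d1(2)] by (simp add: zz)
  have add: "L0_add M F G \<in> carr ?X" "nrm ?X (L0_add M F G) \<le> nrm ?X F + nrm ?X G"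
    if F: "F \<in> carr ?X" and G: "G \<in> carr ?X" for F G
  proof -
    obtain F0 F1 where F': "F0 \<in> carr X0" "F1 \<in> carr X1" "F = L0_add M F0 F1"
      using F by (rule sum_spaceE)
    obtain G0 G1 where G': "G0 \<in> carr X0" "G1 \<in> carr X1" "G = L0_add M G0 G1"
      using G by (rule sum_spaceE)
    have "L0_add M F G = L0_add M (L0_add M F0 G0) (L0_add M F1 G1)"
      unfolding F'(3) G'(3) using F' G' by (intro L0_add_add_commute d0(1) d1(1))
    then show "L0_add M F G \<in> carr ?X"
      using F' G' by (simp add: sum_spaceI d0(3) d1(3))
    show "nrm ?X (L0_add M F G) \<le> nrm ?X F + nrm ?X G"
    proof (rule field_le_epsilon)
      fix e :: real assume "0 < e"
      then have e: "0 < e / 2" by simp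
      obtain F0 F1 where F': "F0 \<in> carr X0" "F1 \<in> carr X1" "F = L0_add M F0 F1"
        and Fl: "nrm X0 F0 + nrm X1 F1 < nrm (sum_space M X0 X1) F + e / 2"
        using sum_norm_approx[OF F e] .
      obtain G0 G1 where G': "G0 \<in> carr X0" "G1 \<in> carr X1" "G = L0_add M G0 G1"
        and Gl: "nrm X0 G0 + nrm X1 G1 < nrm (sum_space M X0 X1) G + e / 2"
        using sum_norm_approx[OF G e] .
      have "L0_add M F G = L0_add M (L0_add M F0 G0) (L0_add M F1 G1)"
        unfolding F'(3) G'(3) using F' G' by (intro L0_add_add_commute d0(1) d1(1))
      then have "nrm ?X (L0_add M F G) \<le> nrm X0 (L0_add M F0 G0) + nrm X1 (L0_add M F1 G1)"
        using F' G' by (simp add: sum_norm_le d0(3) d1(3))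
      also have "\<dots> \<le> (nrm X0 F0 + nrm X0 G0) + (nrm X1 F1 + nrm X1 G1)"
        using F' G' by (intro add_mono d0(8) d1(8))
      finally show "nrm ?X (L0_add M F G) \<le> nrm ?X F + nrm ?X G + e" using Fl Gl by linarith
    qed
  qed
  have scale: "nrm ?X (L0_scale M c F) = cmod c * nrm ?X F" if F: "F \<in> carr ?X" for c F
  proof (cases "c = 0")
    case True
    then show ?thesis using sum_space_scale[OF F, of c] sum_norm_nonneg[OF sum_space_scale(1)[OF F, of c]] by simp
  next
    case False
    note FL = sum_space_L0[OF F]
    have "L0_scale M (1 / c) (L0_scale M c F) = F"
      using FL False by (elim L0E) (simp add: L0_cls_simps)
    then have "nrm ?X F \<le> cmod (1 / c) * nrm ?X (L0_scale M c F)"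
      using sum_space_scale(2)[OF sum_space_scale(1)[OF F, of c], of "1 / c"] by simp
    then have "cmod c * nrm ?X F \<le> nrm ?X (L0_scale M c F)"
      using False by (simp add: norm_divide field_simps)
    with sum_space_scale(2)[OF F, of c] show ?thesis by simp
  qed
  have definite: "F = L0_zero M" if F: "F \<in> carr ?X" and n0: "nrm ?X F = 0" for F
  proof -
    have "\<exists>U. fst U \<in> carr X0 \<and> snd U \<in> carr X1 \<and> F = L0_add M (fst U) (snd U) \<and>
        nrm X0 (fst U) + nrm X1 (snd U) < inverse (real (Suc n))" for n
    proof -
      have e: "0 < inverse (real (Suc n))" by simp
      obtain F0 F1 where "F0 \<in> carr X0" "F1 \<in> carr X1" "F = L0_add M F0 F1"
          "nrm X0 F0 + nrm X1 F1 < nrm ?X F + inverse (real (Suc n))"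
        using sum_norm_approx[OF F e] .
      then show ?thesis using n0 by (intro exI[of _ "(F0, F1)"]) simp
    qed
    then obtain U where U: "\<And>n. fst (U n) \<in> carr X0 \<and> snd (U n) \<in> carr X1 \<and> F = L0_add M (fst (U n)) (snd (U n)) \<and>
        nrm X0 (fst (U n)) + nrm X1 (snd (U n)) < inverse (real (Suc n))" by metis
    define u v where "u n = fst (U n)" and "v n = snd (U n)" for n
    have uv: "u n \<in> carr X0" "v n \<in> carr X1" "F = L0_add M (u n) (v n)"
      and less: "nrm X0 (u n) + nrm X1 (v n) < inverse (real (Suc n))" for n
      using U[of n] by (auto simp: u_def v_def)
    have dz: "L0_diff M H (L0_zero M) = H" if "H \<in> L0 M" for H
      using that by (elim L0E) (simp add: L0_cls_simps)
    have u0: "(\<lambda>n. nrm X0 (L0_diff M (u n) (L0_zero M))) \<longlonglongrightarrow> 0"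
    proof (rule tendsto_sandwich[OF _ _ tendsto_const LIMSEQ_inverse_real_of_nat]; intro always_eventually allI)
      fix n show "0 \<le> nrm X0 (L0_diff M (u n) (L0_zero M))" using uv(1) by (simp add: dz d0(1,5))
      show "nrm X0 (L0_diff M (u n) (L0_zero M)) \<le> inverse (real (Suc n))"
        using less[of n] d1(5)[OF uv(2)[of n]] by (simp add: dz d0(1)[OF uv(1)])
    qed
    have v0: "(\<lambda>n. nrm X1 (L0_diff M (v n) (L0_zero M))) \<longlonglongrightarrow> 0"
    proof (rule tendsto_sandwich[OF _ _ tendsto_const LIMSEQ_inverse_real_of_nat]; intro always_eventually allI)
      fix n show "0 \<le> nrm X1 (L0_diff M (v n) (L0_zero M))" using uv(2) by (simp add: dz d1(1,5))
      show "nrm X1 (L0_diff M (v n) (L0_zero M)) \<le> inverse (real (Suc n))"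
        using less[of n] d0(5)[OF uv(1)[of n]] by (simp add: dz d1(1)[OF uv(2)])
    qed
    show ?thesis
    proof (rule tendsto_L0_zero_sum[OF sf _ _ _ _ uv(3)])
      show "tendsto_L0 M u (L0_zero M)"
        using emb(1) uv(1) u0 d0(2) unfolding continuously_embedded_def by blast
      show "tendsto_L0 M v (L0_zero M)"
        using emb(2) uv(2) v0 d1(2) unfolding continuously_embedded_def by blast
    qed (intro d0(1) d1(1) uv)+
  qed
  have "carr ?X \<subseteq> L0 M"
    using sum_space_L0 by blast
  then show ?thesis
    unfolding normed_subspace_def
    by (intro conjI ballI allI zero add scale sum_space_scale(1) sum_norm_nonneg iffI definite)
      (simp_all add: nz)
qed

end

section \<open>Function representatives in the Calderon space\<close>

lemma fmemD: "f \<in> fmem M X \<Longrightarrow> f \<in> borel_measurable M" "f \<in> fmem M X \<Longrightarrow> cls M f \<in> carr X"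
  by (auto simp: fmem_def)

lemma fmem_rep:
  assumes "normed_subspace M X" "F \<in> carr X"
  shows "rep F \<in> fmem M X" "cls M (rep F) = F"
  using normed_subspaceD(1)[OF assms] assms(2) rep_measurable[of F M] cls_rep[of F M] by (auto simp: fmem_def)

context
  fixes M :: "'s measure" and X :: "'s fclass nspace"
  assumes X: "normed_subspace M X"
begin

interpretation function_seminorm "fmem M X" "fnrm M X"
  by (rule function_seminorm_fnrm[OF X])

lemma norm_continuous_on_iff:
  assumes m: "\<And>z. z \<in> D \<Longrightarrow> G z \<in> borel_measurable M" and g: "\<And>z. z \<in> D \<Longrightarrow> g z = cls M (G z)"
  shows "norm_continuous_on M X D g \<longleftrightarrow> cont D G"
proof -
  have "((\<lambda>w. nrm X (L0_diff M (g w) (g z))) \<longlongrightarrow> 0) (at z within D) \<longleftrightarrow>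
      ((\<lambda>w. fnrm M X (\<lambda>s. G w s - G z s)) \<longlongrightarrow> 0) (at z within D)" if z: "z \<in> D" for z
  proof (rule filterlim_cong[OF refl refl])
    have "\<forall>\<^sub>F w in at z within D. w \<in> D"
      by (simp add: eventually_at_filter)
    then show "\<forall>\<^sub>F w in at z within D. nrm X (L0_diff M (g w) (g z)) = fnrm M X (\<lambda>s. G w s - G z s)"
      by eventually_elim (simp add: g z m L0_diff_cls fnrm_def)
  qed
  then show ?thesis by (simp add: norm_continuous_on_def cont_def)
qed

lemma norm_analytic_on_iff:
  assumes D: "open D" and G: "\<And>z. z \<in> D \<Longrightarrow> G z \<in> fmem M X" and g: "\<And>z. z \<in> D \<Longrightarrow> g z = cls M (G z)"
  shows "norm_analytic_on M X D g \<longleftrightarrow> analytic D G"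
proof
  assume L: "norm_analytic_on M X D g"
  show "analytic D G"
    unfolding analytic_def
  proof
    fix z assume z: "z \<in> D"
    obtain r1 where r1: "0 < r1" "ball z r1 \<subseteq> D" using D z by (auto elim: openE)
    obtain r2 c where r2: "0 < r2" "\<And>n. c n \<in> carr X"
      "\<And>w. w \<in> ball z r2 \<Longrightarrow> (\<lambda>N. nrm X (L0_diff M (L0_sum M (\<lambda>n. L0_scale M ((w - z) ^ n) (c n)) N) (g w))) \<longlonglongrightarrow> 0"
      using L z unfolding norm_analytic_on_def by meson
    have rc: "rep (c n) \<in> fmem M X" "cls M (rep (c n)) = c n" for n
      using fmem_rep[OF X r2(2)] by auto
    have "expands G (\<lambda>n. rep (c n)) z (min r1 r2)"
      unfolding expands_def
    proof (intro conjI allI ballI rc)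
      show "0 < min r1 r2" using r1 r2 by simp
      fix w assume w: "w \<in> ball z (min r1 r2)"
      then have wD: "w \<in> D" using r1 by auto
      then show "G w \<in> fmem M X" by (rule G)
      have "L0_diff M (L0_sum M (\<lambda>n. L0_scale M ((w - z) ^ n) (c n)) N) (g w) =
        cls M (\<lambda>s. (\<Sum>n<N. (w - z) ^ n * rep (c n) s) - G w s)" for N
        using L0_power_series_cls[of "\<lambda>n. rep (c n)" M "G w" "\<lambda>n. (w - z) ^ n" N] fmemD(1)[OF rc(1)] fmemD(1)[OF G[OF wD]]
        by (simp add: rc(2) g[OF wD])
      then show "(\<lambda>N. fnrm M X (\<lambda>s. (\<Sum>n<N. (w - z) ^ n * rep (c n) s) - G w s)) \<longlonglongrightarrow> 0"
        using r2(3)[of w] w by (simp add: fnrm_def)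
    qed
    then show "\<exists>r c. ball z r \<subseteq> D \<and> expands G c z r" using r1(2) by (intro exI conjI) auto
  qed
next
  assume R: "analytic D G"
  show "norm_analytic_on M X D g"
    unfolding norm_analytic_on_def
  proof
    fix z assume z: "z \<in> D"
    obtain r c where r: "ball z r \<subseteq> D" "expands G c z r" using R z by (auto simp: analytic_def)
    have c: "c n \<in> fmem M X" for n using r(2) by (simp add: expands_def)
    have "(\<lambda>N. nrm X (L0_diff M (L0_sum M (\<lambda>n. L0_scale M ((w - z) ^ n) (cls M (c n))) N) (g w))) \<longlonglongrightarrow> 0"
      if w: "w \<in> ball z r" for w
    proof -
      have wD: "w \<in> D" using w r by auto
      show ?thesis
        using expands_tendsto[OF r(2) w] fmemD(1)[OF c] fmemD(1)[OF G[OF wD]]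
        by (simp add: g[OF wD] L0_power_series_cls fnrm_def)
    qed
    then show "\<exists>r>0. \<exists>c. (\<forall>n. c n \<in> carr X) \<and>
        (\<forall>w\<in>ball z r. (\<lambda>N. nrm X (L0_diff M (L0_sum M (\<lambda>n. L0_scale M ((w - z) ^ n) (c n)) N) (g w))) \<longlonglongrightarrow> 0)"
      using expands_radius[OF r(2)] fmemD(2)[OF c] by (intro exI[of _ r] exI[of _ "\<lambda>n. cls M (c n)"] conjI) auto
  qed
qed

text \<open>Existence is \<open>expands_derivative\<close>. For uniqueness, two limits of the same
  difference quotient are at distance zero, and definiteness of the norm on classes turns this into
  equality, which settles the definite description.\<close>

lemma norm_deriv_expands:
  assumes G: "expands G c z r" and g: "\<And>w. w \<in> ball z r \<Longrightarrow> g w = cls M (G w)"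
  shows "norm_deriv M X g z = cls M (c 1)"
proof -
  have z: "z \<in> ball z r" using expands_radius[OF G] by simp
  have c1: "c 1 \<in> fmem M X" using G by (simp add: expands_def)
  note m1 = fmemD(1)[OF c1]
  have mG: "G w \<in> fmem M X" if "w \<in> ball z r" for w by (rule expands_mem(2)[OF G that])
  have ev: "\<forall>\<^sub>F w in at z. w \<in> ball z r"
    using expands_radius[OF G] by (auto simp: eventually_at dist_commute intro!: exI[of _ r])
  have Q: "(\<lambda>s. 1 / (w - z) * (G w s - G z s)) \<in> fmem M X" if "w \<in> ball z r" for w
    using that z by (intro scale_mem diff_mem mG)
  have quot: "L0_scale M (1 / (w - z)) (L0_diff M (g w) (g z)) = cls M (\<lambda>s. 1 / (w - z) * (G w s - G z s))"
    if w: "w \<in> ball z r" for w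
    using fmemD(1)[OF mG[OF w]] fmemD(1)[OF mG[OF z]] by (simp add: g[OF w] g[OF z] L0_cls_simps)
  have diff: "nrm X (L0_diff M (L0_scale M (1 / (w - z)) (L0_diff M (g w) (g z))) (cls M e)) =
      fnrm M X (\<lambda>s. 1 / (w - z) * (G w s - G z s) - e s)" if w: "w \<in> ball z r" and e: "e \<in> fmem M X" for w e
    unfolding quot[OF w] fnrm_def by (simp only: L0_diff_cls[OF fmemD(1)[OF Q[OF w]] fmemD(1)[OF e]])
  have lim1: "((\<lambda>w. fnrm M X (\<lambda>s. 1 / (w - z) * (G w s - G z s) - c 1 s)) \<longlongrightarrow> 0) (at z)"
    by (rule expands_derivative[OF G])
  show ?thesis
    unfolding norm_deriv_def
  proof (rule the_equality)
    have "\<forall>\<^sub>F w in at z. fnrm M X (\<lambda>s. 1 / (w - z) * (G w s - G z s) - c 1 s) =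
      nrm X (L0_diff M (L0_scale M (1 / (w - z)) (L0_diff M (g w) (g z))) (cls M (c 1)))"
      using ev by eventually_elim (simp only: diff[OF _ c1])
    then show "has_norm_derivative M X g (cls M (c 1)) z"
      unfolding has_norm_derivative_def using fmemD(2)[OF c1] lim1 by (auto intro: Lim_transform_eventually)
  next
    fix d assume d: "has_norm_derivative M X g d z"
    define e where "e = rep d"
    have e: "e \<in> fmem M X" "cls M e = d"
      using fmem_rep[OF X, of d] d by (auto simp: e_def has_norm_derivative_def)
    note me = fmemD(1)[OF e(1)]
    have "\<forall>\<^sub>F w in at z. nrm X (L0_diff M (L0_scale M (1 / (w - z)) (L0_diff M (g w) (g z))) d) =
       fnrm M X (\<lambda>s. 1 / (w - z) * (G w s - G z s) - e s)"
      using ev unfolding e(2)[symmetric] by eventually_elim (simp only: diff[OF _ e(1)])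
    then have lim2: "((\<lambda>w. fnrm M X (\<lambda>s. 1 / (w - z) * (G w s - G z s) - e s)) \<longlongrightarrow> 0) (at z)"
      using d unfolding has_norm_derivative_def by (blast intro: Lim_transform_eventually)
    have "fnrm M X (\<lambda>s. e s - c 1 s) \<le> 0 + 0"
    proof (rule tendsto_le[OF _ tendsto_add[OF lim2 lim1] tendsto_const])
      show "\<forall>\<^sub>F w in at z. fnrm M X (\<lambda>s. e s - c 1 s) \<le>
        fnrm M X (\<lambda>s. 1 / (w - z) * (G w s - G z s) - e s) + fnrm M X (\<lambda>s. 1 / (w - z) * (G w s - G z s) - c 1 s)"
        using ev
      proof eventually_elim
        case (elim w)
        show ?case
          using triangle_via[OF e(1) Q[OF elim] c1] seminorm_diff_commute[OF e(1) Q[OF elim]] by simp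
      qed
    qed simp
    then have "fnrm M X (\<lambda>s. e s - c 1 s) = 0"
      using nonneg[OF diff_mem[OF e(1) c1]] by simp
    then have "cls M (\<lambda>s. e s - c 1 s) = L0_zero M"
      using normed_subspaceD(6)[OF X fmemD(2)[OF diff_mem[OF e(1) c1]]] by (simp add: fnrm_def)
    then have "AE s in M. e s - c 1 s = 0"
      unfolding L0_zero_def using me m1 by (subst (asm) cls_eq_iff) auto
    then show "d = cls M (c 1)"
      unfolding e(2)[symmetric] using me m1 by (subst cls_eq_iff) auto
  qed
qed

end

definition boundary_fun :: "'s measure \<Rightarrow> 's fclass nspace \<Rightarrow> real \<Rightarrow> (complex \<Rightarrow> 's \<Rightarrow> complex) \<Rightarrow> bool" where
  "boundary_fun M X j G \<longleftrightarrow> (\<forall>t. G (Complex j t) \<in> fmem M X) \<and>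
     (\<exists>K. \<forall>t. fnrm M X (G (Complex j t)) \<le> K) \<and>
     function_seminorm.cont (fnrm M X) UNIV (\<lambda>t. G (Complex j t))"

text \<open>The Calderon space on the level of functions: \<open>calderon_iff\<close> translates
  between this predicate and \<open>calderon_space\<close>, so that sums, weights and quotients can
  be formed pointwise.\<close>

definition calderon_fun :: "'s measure \<Rightarrow> 's fclass nspace \<Rightarrow> 's fclass nspace \<Rightarrow> (complex \<Rightarrow> 's \<Rightarrow> complex) \<Rightarrow> bool" where
  "calderon_fun M X0 X1 G \<longleftrightarrow>
     (\<forall>z\<in>strip. G z \<in> fmem M (sum_space M X0 X1)) \<and>
     (\<exists>K. \<forall>z\<in>strip. fnrm M (sum_space M X0 X1) (G z) \<le> K) \<and>
     function_seminorm.cont (fnrm M (sum_space M X0 X1)) strip G \<and>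
     function_seminorm.analytic (fmem M (sum_space M X0 X1)) (fnrm M (sum_space M X0 X1)) (interior strip) G \<and>
     boundary_fun M X0 0 G \<and> boundary_fun M X1 1 G"

lemma boundary_mem_strip: "Complex 0 t \<in> strip" "Complex 1 t \<in> strip"
  by (auto simp: strip_def)

lemma boundary_condition_iff:
  assumes X: "normed_subspace M X"
    and m: "\<And>t. G (Complex j t) \<in> borel_measurable M" and g: "\<And>t. g (Complex j t) = cls M (G (Complex j t))"
  shows "boundary_condition M X j g \<longleftrightarrow> boundary_fun M X j G"
  unfolding boundary_condition_def boundary_fun_def bounded_map_on_def
  by (subst norm_continuous_on_iff[OF X]) (auto simp: m g fmem_def fnrm_def)

lemma interior_stripI:
  assumes "0 < Re z" "Re z < 1"
  shows "z \<in> interior strip"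
proof (rule interiorI)
  show "open ({z. 0 < Re z} \<inter> {z. Re z < 1})"
    by (intro open_Int open_halfspace_Re_gt open_halfspace_Re_lt)
qed (use assms in \<open>auto simp: strip_def\<close>)

text \<open>The representatives may be chosen independently for each \<open>z\<close>, since every
  condition sees a value only through its class. This allows passing to functions, modifying them
  and returning to classes.\<close>

lemma calderon_iff:
  assumes X: "normed_subspace M X0" "normed_subspace M X1" "normed_subspace M (sum_space M X0 X1)"
    and m: "\<And>z. z \<in> strip \<Longrightarrow> G z \<in> borel_measurable M"
    and g: "\<And>z. z \<in> strip \<Longrightarrow> g z = cls M (G z)"
  shows "g \<in> carr (calderon_space M X0 X1) \<longleftrightarrow> calderon_fun M X0 X1 G"
proof -
  let ?S = "sum_space M X0 X1"
  have mem: "(\<forall>z\<in>strip. g z \<in> carr ?S) \<longleftrightarrow> (\<forall>z\<in>strip. G z \<in> fmem M ?S)"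
    using m g by (auto simp: fmem_def)
  have bd: "bounded_map_on ?S strip g \<longleftrightarrow> (\<exists>K. \<forall>z\<in>strip. fnrm M ?S (G z) \<le> K)"
    using g by (auto simp: bounded_map_on_def fnrm_def)
  have co: "norm_continuous_on M ?S strip g \<longleftrightarrow> function_seminorm.cont (fnrm M ?S) strip G"
    by (rule norm_continuous_on_iff[OF X(3) m g])
  have an: "norm_analytic_on M ?S (interior strip) g \<longleftrightarrow>
      function_seminorm.analytic (fmem M ?S) (fnrm M ?S) (interior strip) G"
    if "\<forall>z\<in>strip. G z \<in> fmem M ?S"
    using that g interior_subset[of strip] by (intro norm_analytic_on_iff[OF X(3)]) auto
  have b0: "boundary_condition M X0 0 g \<longleftrightarrow> boundary_fun M X0 0 G"
    by (intro boundary_condition_iff X m g boundary_mem_strip)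
  have b1: "boundary_condition M X1 1 g \<longleftrightarrow> boundary_fun M X1 1 G"
    by (intro boundary_condition_iff X m g boundary_mem_strip)
  show ?thesis
    unfolding calderon_space_def calderon_fun_def nspace.simps mem_Collect_eq mem bd co b0 b1
    using an by blast
qed

lemma boundary_fun_diff:
  assumes X: "normed_subspace M X" and G: "boundary_fun M X j G" and H: "boundary_fun M X j H"
  shows "boundary_fun M X j (\<lambda>z s. G z s - H z s)"
proof -
  interpret function_seminorm "fmem M X" "fnrm M X" by (rule function_seminorm_fnrm[OF X])
  have mG: "G (Complex j t) \<in> fmem M X" and mH: "H (Complex j t) \<in> fmem M X" for t
    using G H by (auto simp: boundary_fun_def)
  obtain K L where K: "\<And>t. fnrm M X (G (Complex j t)) \<le> K" and L: "\<And>t. fnrm M X (H (Complex j t)) \<le> L"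
    using G H by (auto simp: boundary_fun_def)
  have "fnrm M X (\<lambda>s. G (Complex j t) s - H (Complex j t) s) \<le> K + L" for t
    using triangle_diff[OF mG mH, of t t] K[of t] L[of t] by linarith
  then show ?thesis
    unfolding boundary_fun_def using G H
    by (intro conjI allI exI[of _ "K + L"] diff_mem mG mH cont_diff) (auto simp: boundary_fun_def)
qed

lemma calderon_fun_diff:
  assumes X: "normed_subspace M X0" "normed_subspace M X1" "normed_subspace M (sum_space M X0 X1)"
    and G: "calderon_fun M X0 X1 G" and H: "calderon_fun M X0 X1 H"
  shows "calderon_fun M X0 X1 (\<lambda>z s. G z s - H z s)"
proof -
  let ?S = "sum_space M X0 X1"
  interpret function_seminorm "fmem M ?S" "fnrm M ?S" by (rule function_seminorm_fnrm[OF X(3)])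
  have mG: "G z \<in> fmem M ?S" and mH: "H z \<in> fmem M ?S" if "z \<in> strip" for z
    using G H that by (auto simp: calderon_fun_def)
  obtain K where K: "\<And>z. z \<in> strip \<Longrightarrow> fnrm M ?S (G z) \<le> K"
    using G unfolding calderon_fun_def by meson
  obtain L where L: "\<And>z. z \<in> strip \<Longrightarrow> fnrm M ?S (H z) \<le> L"
    using H unfolding calderon_fun_def by meson
  have "fnrm M ?S (\<lambda>s. G z s - H z s) \<le> K + L" if "z \<in> strip" for z
    using triangle_diff[OF mG[OF that] mH[OF that]] K[OF that] L[OF that] by linarith
  then show ?thesis
    unfolding calderon_fun_def using G H
    by (intro conjI ballI exI[of _ "K + L"] diff_mem mG mH cont_diff analytic_diff boundary_fun_diff X)
      (auto simp: calderon_fun_def)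
qed

lemma calderon_fun_wcomp:
  assumes X: "normed_subspace M X0" "normed_subspace M X1" "normed_subspace M (sum_space M X0 X1)"
    and T: "\<And>X f. X \<in> {X0, X1, sum_space M X0 X1} \<Longrightarrow> f \<in> fmem M X \<Longrightarrow>
      wcomp \<epsilon> \<tau> f \<in> fmem M X \<and> fnrm M X (wcomp \<epsilon> \<tau> f) \<le> fnrm M X f"
    and G: "calderon_fun M X0 X1 G"
  shows "calderon_fun M X0 X1 (\<lambda>z. wcomp \<epsilon> \<tau> (G z))"
proof -
  let ?S = "sum_space M X0 X1"
  have bdry: "boundary_fun M X j (\<lambda>z. wcomp \<epsilon> \<tau> (G z))"
    if Y: "normed_subspace M X" "X \<in> {X0, X1, sum_space M X0 X1}" and b: "boundary_fun M X j G" for X j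
  proof -
    interpret function_seminorm "fmem M X" "fnrm M X" by (rule function_seminorm_fnrm[OF Y(1)])
    have mG: "G (Complex j t) \<in> fmem M X" for t
      using b by (auto simp: boundary_fun_def)
    obtain K where K: "\<And>t. fnrm M X (G (Complex j t)) \<le> K"
      using b by (auto simp: boundary_fun_def)
    have T1: "wcomp \<epsilon> \<tau> f \<in> fmem M X" and T2: "fnrm M X (wcomp \<epsilon> \<tau> f) \<le> fnrm M X f" if "f \<in> fmem M X" for f
      using T[OF Y(2) that] by auto
    have "fnrm M X (wcomp \<epsilon> \<tau> (G (Complex j t))) \<le> K" for t
      using T2[OF mG] K[of t] by (rule order_trans)
    then show ?thesis
      unfolding boundary_fun_def using b mG
      by (intro conjI allI exI[of _ K] T1 cont_wcomp T2) (auto simp: boundary_fun_def)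
  qed
  interpret function_seminorm "fmem M ?S" "fnrm M ?S" by (rule function_seminorm_fnrm[OF X(3)])
  have T1: "wcomp \<epsilon> \<tau> f \<in> fmem M ?S" and T2: "fnrm M ?S (wcomp \<epsilon> \<tau> f) \<le> fnrm M ?S f" if "f \<in> fmem M ?S" for f
    using T[OF _ that] by auto
  have mG: "G z \<in> fmem M ?S" if "z \<in> strip" for z
    using G that by (auto simp: calderon_fun_def)
  obtain K where K: "\<And>z. z \<in> strip \<Longrightarrow> fnrm M ?S (G z) \<le> K"
    using G by (auto simp: calderon_fun_def)
  have "fnrm M ?S (wcomp \<epsilon> \<tau> (G z)) \<le> K" if "z \<in> strip" for z
    using T2[OF mG[OF that]] K[OF that] by (rule order_trans)
  then show ?thesis
    unfolding calderon_fun_def using G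
    by (intro conjI ballI exI[of _ K] T1 mG cont_wcomp T2 analytic_wcomp bdry X) (auto simp: calderon_fun_def)
qed

text \<open>On the line \<open>Re z = j\<close> the distance to \<open>a\<close> is at least
  \<open>\<bar>Re a - j\<bar>\<close>, which gives the denominator. As \<open>a\<close> lies off the
  line, the value \<open>f\<close> filled in at \<open>a\<close> is arbitrary.\<close>

lemma boundary_fun_removed:
  assumes X: "normed_subspace M X" and G: "boundary_fun M X j G" and a: "Re a \<noteq> j"
    and K: "\<And>t. fnrm M X (G (Complex j t)) \<le> K"
  shows "boundary_fun M X j (removed a f G)" (is ?B)
    and "fnrm M X (removed a f G (Complex j t)) \<le> K / \<bar>Re a - j\<bar>" (is ?N)
proof -
  interpret function_seminorm "fmem M X" "fnrm M X" by (rule function_seminorm_fnrm[OF X])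
  have ne: "Complex j t \<noteq> a" for t using a by auto
  have rm: "removed a f G (Complex j t) = (\<lambda>s. 1 / (Complex j t - a) * G (Complex j t) s)" for t
    using ne[of t] by (simp add: removed_def)
  have mG: "G (Complex j t) \<in> fmem M X" for t
    using G by (auto simp: boundary_fun_def)
  have bound: "fnrm M X (removed a f G (Complex j t)) \<le> K / \<bar>Re a - j\<bar>" for t
  proof -
    have "\<bar>Re a - j\<bar> \<le> cmod (Complex j t - a)"
      using abs_Re_le_cmod[of "Complex j t - a"] by simp
    then have "fnrm M X (G (Complex j t)) / cmod (Complex j t - a) \<le> K / \<bar>Re a - j\<bar>"
      using a K[of t] nonneg[OF mG[of t]] by (intro frac_le) auto
    then show ?thesis unfolding rm homogeneous[OF mG] by (simp add: norm_divide)
  qed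
  then show ?N .
  have "(\<lambda>t. Complex j t) = (\<lambda>t. complex_of_real j + \<i> * complex_of_real t)"
    by (rule ext) (simp add: complex_eq_iff)
  then have "continuous_on UNIV (\<lambda>t. Complex j t)"
    by (simp add: continuous_intros)
  then have "continuous_on UNIV (\<lambda>t. 1 / (Complex j t - a))"
    using ne by (intro continuous_intros) auto
  then have "cont UNIV (\<lambda>t s. 1 / (Complex j t - a) * G (Complex j t) s)"
    using G by (intro cont_scale mG) (auto simp: boundary_fun_def)
  then show ?B
    unfolding boundary_fun_def using bound unfolding rm
    by (intro conjI allI exI[of _ "K / \<bar>Re a - j\<bar>"] scale_mem mG)
qed

section \<open>The natural complex structure as a weighted composition operator\<close>

text \<open>Writing an even index as a successor removes the truncated subtraction in
  \<open>swap_perm\<close>.\<close>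

lemma swap_perm_cases:
  assumes "1 \<le> n"
  obtains (odd) "odd n" "swap_perm n = Suc n" | (even) m where "n = Suc m" "odd m" "swap_perm n = m"
  using assms by (cases n) (auto simp: swap_perm_def)

lemma swap_perm_ge_1: "1 \<le> n \<Longrightarrow> 1 \<le> swap_perm n"
  by (erule swap_perm_cases) (auto simp: odd_pos Suc_leI)

lemma swap_perm_swap_perm: "1 \<le> n \<Longrightarrow> swap_perm (swap_perm n) = n"
  by (erule swap_perm_cases) (auto simp: swap_perm_def)

lemma power_swap_perm: "1 \<le> n \<Longrightarrow> (-1) ^ swap_perm n = - ((-1) ^ n :: complex)"
  by (erule swap_perm_cases) simp_all

lemma bij_swap_perm: "bij_betw swap_perm {1..} {1..}"
  by (rule bij_betwI[of _ _ _ swap_perm]; (intro Pi_I)?)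
    (simp_all only: atLeast_iff swap_perm_ge_1 swap_perm_swap_perm)

section \<open>The involution and the sign behind the natural complex structure\<close>

definition piece :: "(nat \<Rightarrow> 's set) \<Rightarrow> 's \<Rightarrow> nat" where
  "piece S s = (THE n. 1 \<le> n \<and> s \<in> S n)"

definition nat_map :: "(nat \<Rightarrow> 's set) \<Rightarrow> (nat \<Rightarrow> 's \<Rightarrow> 's) \<Rightarrow> 's \<Rightarrow> 's" where
  "nat_map S a s = a (piece S s) s"

text \<open>The value 0 off \<open>space M\<close> matches the series in
  \<open>natural_complex_structure\<close>, all of whose terms vanish there; the two descriptions
  then agree at every point.\<close>

definition nat_sign :: "'s measure \<Rightarrow> (nat \<Rightarrow> 's set) \<Rightarrow> 's \<Rightarrow> complex" where
  "nat_sign M S s = (if s \<in> space M then (-1) ^ piece S s else 0)"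

lemma L2_space_cls:
  assumes f: "f \<in> borel_measurable M"
  shows "cls M f \<in> carr (L2_space M) \<longleftrightarrow> integrable M (\<lambda>s. (cmod (f s))\<^sup>2)"
    and "nrm (L2_space M) (cls M f) = sqrt (\<integral>s. (cmod (f s))\<^sup>2 \<partial>M)"
proof -
  have ae: "AE s in M. (cmod (rep (cls M f) s))\<^sup>2 = (cmod (f s))\<^sup>2"
    using rep_cls_AE[OF f] by (rule eventually_mono) simp
  have m: "(\<lambda>s. (cmod (g s))\<^sup>2) \<in> borel_measurable M" if "g \<in> borel_measurable M" for g :: "'a \<Rightarrow> complex"
    using that by simp
  note cong = m[OF rep_cls_measurable[OF f]] m[OF f] ae
  show "cls M f \<in> carr (L2_space M) \<longleftrightarrow> integrable M (\<lambda>s. (cmod (f s))\<^sup>2)"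
    unfolding L2_space_def nspace.simps mem_Collect_eq integrable_cong_AE[OF cong] by (simp add: cls_in_L0 f)
  show "nrm (L2_space M) (cls M f) = sqrt (\<integral>s. (cmod (f s))\<^sup>2 \<partial>M)"
    unfolding L2_space_def nspace.simps integral_cong_AE[OF cong] ..
qed

locale natural_structure =
  fixes M :: "'s measure" and S :: "nat \<Rightarrow> 's set" and a :: "nat \<Rightarrow> 's \<Rightarrow> 's"
  assumes data: "natural_structure_data M S a"
begin

abbreviation "\<tau> \<equiv> nat_map S a"
abbreviation "\<epsilon> \<equiv> nat_sign M S"
abbreviation "W \<equiv> wcomp \<epsilon> \<tau>"
abbreviation "\<omega> \<equiv> natural_complex_structure M S a"

lemma data_parts:
  shows "\<forall>n\<ge>1. S n \<in> sets M \<and> emeasure M (S n) > 0"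
    and disjoint_S: "disjoint_family_on S {1..}"
    and S_Un: "(\<Union>n\<in>{1..}. S n) = space M"
    and "\<forall>n\<ge>1. measure_preserving_bij M (S n) (S (swap_perm n)) (a n)"
    and "\<forall>n\<ge>1. \<forall>s\<in>S (swap_perm n). a (swap_perm n) s = inv_into (S n) (a n) s"
  using data unfolding natural_structure_data_def by - (elim conjE, assumption)+

lemma
  assumes "1 \<le> n"
  shows S_sets: "S n \<in> sets M"
    and a_bij: "bij_betw (a n) (S n) (S (swap_perm n))"
    and a_meas: "a n \<in> measurable (restrict_space M (S n)) (restrict_space M (S (swap_perm n)))"
    and a_emeasure: "E \<in> sets M \<Longrightarrow> E \<subseteq> S (swap_perm n) \<Longrightarrow> emeasure M (a n -` E \<inter> S n) = emeasure M E"
    and a_inv: "s \<in> S (swap_perm n) \<Longrightarrow> a (swap_perm n) s = inv_into (S n) (a n) s"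
  using data_parts(1,4,5)[rule_format, OF assms] by (simp_all only: measure_preserving_bij_def)

lemma S_disjoint:
  assumes "1 \<le> m" "1 \<le> n" "s \<in> S m" "s \<in> S n"
  shows "m = n"
proof (rule ccontr)
  assume "m \<noteq> n"
  then have "S m \<inter> S n = {}"
    using assms by (intro disjoint_family_onD[OF disjoint_S]) auto
  then show False using assms by auto
qed

lemma piece_eq:
  assumes "1 \<le> n" "s \<in> S n"
  shows "piece S s = n"
  unfolding piece_def
proof (rule the_equality)
  show "1 \<le> n \<and> s \<in> S n" using assms by (rule conjI)
  show "m = n" if "1 \<le> m \<and> s \<in> S m" for m
    by (rule S_disjoint[OF conjunct1[OF that] assms(1) conjunct2[OF that] assms(2)])
qed

lemma spaceE:
  assumes "s \<in> space M"
  obtains n where "1 \<le> n" "s \<in> S n" "piece S s = n" "\<tau> s = a n s" "\<epsilon> s = (-1) ^ n"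
proof -
  have "s \<in> (\<Union>n\<in>{1..}. S n)" using assms unfolding S_Un .
  then obtain n where n: "1 \<le> n" "s \<in> S n" by auto
  then show ?thesis using that[of n] piece_eq[OF n] assms by (simp add: nat_map_def nat_sign_def)
qed

lemma a_mem: "1 \<le> n \<Longrightarrow> s \<in> S n \<Longrightarrow> a n s \<in> S (swap_perm n)"
  by (rule bij_betw_apply[OF a_bij])

lemma S_space: "1 \<le> n \<Longrightarrow> S n \<subseteq> space M"
  by (rule sets.sets_into_space[OF S_sets])

text \<open>The map on the partner piece is the inverse of \<open>a n\<close>, so applying
  \<open>\<tau>\<close> twice returns to the start. Partner indices have opposite parity, so the
  sign flips along \<open>\<tau>\<close>; this flip is what makes the square of
  \<open>\<omega>\<close> equal to minus the identity.\<close>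

lemma \<tau>_involution:
  assumes s: "s \<in> space M"
  shows "\<tau> s \<in> space M" "\<tau> (\<tau> s) = s" "\<epsilon> (\<tau> s) = - \<epsilon> s" "cmod (\<epsilon> s) = 1"
proof -
  obtain n where n: "1 \<le> n" "s \<in> S n" "piece S s = n" "\<tau> s = a n s" "\<epsilon> s = (-1) ^ n"
    using s by (rule spaceE)
  have as: "a n s \<in> S (swap_perm n)" using n by (intro a_mem)
  note sw = swap_perm_ge_1[OF n(1)]
  show sp: "\<tau> s \<in> space M" using as S_space[OF sw] n by auto
  have p: "piece S (\<tau> s) = swap_perm n" using piece_eq[OF sw as] n by simp
  have "a (swap_perm n) (a n s) = s"
    using a_inv[OF n(1) as] a_bij[OF n(1)] n(2) by (simp add: bij_betw_def inv_into_f_f)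
  then show "\<tau> (\<tau> s) = s" unfolding nat_map_def[of S a "\<tau> s"] p by (simp add: n)
  show "\<epsilon> (\<tau> s) = - \<epsilon> s" using sp p n power_swap_perm[OF n(1)] by (simp add: nat_sign_def s)
  show "cmod (\<epsilon> s) = 1" using n by (simp add: norm_power)
qed

lemma \<tau>_measurable [measurable]: "\<tau> \<in> measurable M M"
proof (rule measurable_piecewise_restrict[of "S ` {1..}"])
  fix \<Omega> assume "\<Omega> \<in> S ` {1..}"
  then obtain n where n: "1 \<le> n" "\<Omega> = S n" by auto
  show "\<Omega> \<inter> space M \<in> sets M" using n S_sets by auto
  have "a n \<in> measurable (restrict_space M (S n)) M"
    using a_meas[OF n(1)] by (simp add: measurable_restrict_space2_iff)
  then show "\<tau> \<in> measurable (restrict_space M \<Omega>) M"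
    unfolding n(2) by (rule measurable_cong[THEN iffD1, rotated])
      (auto simp: n nat_map_def piece_eq[OF n(1)] space_restrict_space)
qed (use S_Un in auto)

lemma \<epsilon>_measurable [measurable]: "\<epsilon> \<in> borel_measurable M"
proof (rule measurable_piecewise_restrict[of "S ` {1..}"])
  fix \<Omega> assume "\<Omega> \<in> S ` {1..}"
  then obtain n where n: "1 \<le> n" "\<Omega> = S n" by auto
  show "\<Omega> \<inter> space M \<in> sets M" using n S_sets by auto
  have "(\<lambda>s. (-1) ^ n :: complex) \<in> borel_measurable (restrict_space M \<Omega>)" by simp
  then show "\<epsilon> \<in> borel_measurable (restrict_space M \<Omega>)"
    by (rule measurable_cong[THEN iffD1, rotated])
      (auto simp: n nat_sign_def piece_eq[OF n(1)] space_restrict_space)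
qed (use S_Un in auto)

text \<open>Over the piece \<open>S n\<close> the preimage is that of
  \<open>E \<inter> S (swap_perm n)\<close> under \<open>a n\<close>, hence of the same measure.
  Summing over all pieces, the bijection \<open>swap_perm\<close> merely permutes the terms.\<close>

lemma emeasure_vimage_\<tau>:
  assumes E: "E \<in> sets M"
  shows "emeasure M (\<tau> -` E \<inter> space M) = emeasure M E"
proof -
  have pre: "\<tau> -` E \<inter> S n = a n -` (E \<inter> S (swap_perm n)) \<inter> S n" if "1 \<le> n" for n
    using a_mem[OF that] piece_eq[OF that] by (auto simp: nat_map_def)
  have em: "emeasure M (\<tau> -` E \<inter> S n) = emeasure M (E \<inter> S (swap_perm n))" if n: "1 \<le> n" for n
    unfolding pre[OF n] using E S_sets[OF swap_perm_ge_1[OF n]] by (intro a_emeasure[OF n]) auto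
  note disj = disjoint_S
  have "\<tau> -` E \<inter> space M = (\<Union>n\<in>{1..}. \<tau> -` E \<inter> S n)"
    unfolding S_Un[symmetric] by auto
  moreover have "emeasure M (\<Union>n\<in>{1..}. \<tau> -` E \<inter> S n) = (\<integral>\<^sup>+n. emeasure M (\<tau> -` E \<inter> S n) \<partial>count_space {1..})"
  proof (rule emeasure_UN_countable)
    fix n :: nat assume "n \<in> {1..}"
    then have n: "1 \<le> n" by simp
    have "\<tau> -` E \<inter> S n = (\<tau> -` E \<inter> space M) \<inter> S n" using S_space[OF n] by auto
    then show "\<tau> -` E \<inter> S n \<in> sets M" using measurable_sets[OF \<tau>_measurable E] S_sets[OF n] by auto
  next
    show "disjoint_family_on (\<lambda>n. \<tau> -` E \<inter> S n) {1..}"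
      using disj by (auto simp: disjoint_family_on_def)
  qed auto
  moreover have "(\<integral>\<^sup>+n. emeasure M (\<tau> -` E \<inter> S n) \<partial>count_space {1..}) =
      (\<integral>\<^sup>+n. emeasure M (E \<inter> S (swap_perm n)) \<partial>count_space {1..})"
    by (rule nn_integral_cong) (simp add: em)
  moreover have "\<dots> = (\<integral>\<^sup>+n. emeasure M (E \<inter> S n) \<partial>count_space {1..})"
    by (rule nn_integral_bij_count_space[OF bij_swap_perm])
  moreover have "\<dots> = emeasure M (\<Union>n\<in>{1..}. E \<inter> S n)"
    using disj E S_sets by (intro emeasure_UN_countable[symmetric]) (auto simp: disjoint_family_on_def)
  moreover have "(\<Union>n\<in>{1..}. E \<inter> S n) = E \<inter> (\<Union>n\<in>{1..}. S n)" by blast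
  then have "(\<Union>n\<in>{1..}. E \<inter> S n) = E"
    unfolding S_Un using sets.sets_into_space[OF E] by auto
  ultimately show ?thesis by simp
qed

lemma distr_\<tau>: "distr M M \<tau> = M"
  by (rule measure_eqI) (auto simp: emeasure_distr emeasure_vimage_\<tau>)

lemma W_measurable [measurable]: "f \<in> borel_measurable M \<Longrightarrow> W f \<in> borel_measurable M"
  unfolding wcomp_def by (intro borel_measurable_times \<epsilon>_measurable measurable_compose[OF \<tau>_measurable])

text \<open>Because \<open>\<tau>\<close> preserves the measure, preimages of null sets are null;
  this is what makes \<open>W\<close> well defined on classes.\<close>

lemma W_AE:
  assumes [measurable]: "f \<in> borel_measurable M" "g \<in> borel_measurable M" and ae: "AE s in M. f s = g s"
  shows "AE s in M. W f s = W g s"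
proof -
  have "AE s in distr M M \<tau>. f s = g s" using ae unfolding distr_\<tau> .
  then have "AE s in M. f (\<tau> s) = g (\<tau> s)" by (subst (asm) AE_distr_iff) auto
  then show ?thesis by eventually_elim (simp add: wcomp_def)
qed

text \<open>By disjointness at most one term of the series is nonzero, namely the one indexed by the
  piece containing the point.\<close>

lemma \<omega>_rep: "\<omega> F = cls M (W (rep F))"
proof -
  have "(\<Sum>n. if n \<ge> 1 \<and> s \<in> S n then (-1) ^ n * rep F (a n s) else 0) = W (rep F) s" for s
  proof (cases "s \<in> space M")
    case True
    then obtain n where n: "1 \<le> n" "s \<in> S n" "piece S s = n" "\<tau> s = a n s" "\<epsilon> s = (-1) ^ n"
      by (rule spaceE)
    have "(\<lambda>k. if k \<ge> 1 \<and> s \<in> S k then (-1) ^ k * rep F (a k s) else 0) =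
        (\<lambda>k. if k = n then (-1) ^ k * rep F (a k s) else 0)"
    proof (rule ext)
      show "(if k \<ge> 1 \<and> s \<in> S k then (-1) ^ k * rep F (a k s) else 0) =
          (if k = n then (-1) ^ k * rep F (a k s) else 0)" for k
        using S_disjoint[of k n s] n(1,2) by (cases "k = n") auto
    qed
    then show ?thesis
      using sums_unique[OF sums_single[of n "\<lambda>k. (-1) ^ k * rep F (a k s)"]] n by (simp add: wcomp_def)
  next
    case False
    then have "\<not> (k \<ge> 1 \<and> s \<in> S k)" for k using S_space[of k] by auto
    then show ?thesis using False by (simp only: if_False suminf_zero) (simp add: wcomp_def nat_sign_def)
  qed
  then show ?thesis unfolding natural_complex_structure_def by (simp only:)
qed

lemma \<omega>_cls:
  assumes "f \<in> borel_measurable M"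
  shows "\<omega> (cls M f) = cls M (W f)"
  unfolding \<omega>_rep using assms rep_cls_measurable[OF assms] W_AE[OF _ _ rep_cls_AE[OF assms]]
  by (subst cls_eq_iff) auto

text \<open>The two weights multiply to \<open>\<epsilon> s * \<epsilon> (\<tau> s) = - (\<epsilon>
  s)^2 = -1\<close>.\<close>

lemma W_W: "s \<in> space M \<Longrightarrow> W (W f) s = - f s"
proof -
  assume s: "s \<in> space M"
  obtain n where "\<epsilon> s = (-1) ^ n" using s by (rule spaceE)
  then have "\<epsilon> s * \<epsilon> s = 1" by (simp flip: power_mult_distrib)
  then show ?thesis unfolding wcomp_def \<tau>_involution(2,3)[OF s] by (simp flip: mult.assoc)
qed

lemma W_linear: "W (\<lambda>s. f s + g s) = (\<lambda>s. W f s + W g s)" "W (\<lambda>s. f s - g s) = (\<lambda>s. W f s - W g s)"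
    "W (\<lambda>s. c * f s) = (\<lambda>s. c * W f s)"
  by (auto simp: wcomp_def algebra_simps)

lemma norm_W: "s \<in> space M \<Longrightarrow> cmod (W f s) = cmod (f (\<tau> s))"
  using \<tau>_involution(4) by (simp add: wcomp_def norm_mult)

text \<open>The weight is unimodular on the space, so the set where \<open>|W f|\<close> exceeds
  \<open>t\<close> is the preimage under \<open>\<tau>\<close> of the corresponding set for
  \<open>f\<close>.\<close>

lemma equimeasurable_W:
  assumes [measurable]: "f \<in> borel_measurable M"
  shows "equimeasurable M (cls M (W f)) (cls M f)"
  unfolding equimeasurable_def
proof (intro allI impI)
  fix t :: real
  have rep: "emeasure M {s \<in> space M. t < cmod (rep (cls M g) s)} = emeasure M {s \<in> space M. t < cmod (g s)}"
    if [measurable]: "g \<in> borel_measurable M" for g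
  proof -
    note [measurable] = rep_cls_measurable[OF that]
    show ?thesis using rep_cls_AE[OF that] by (intro emeasure_eq_AE) (auto elim: eventually_mono)
  qed
  have "{s \<in> space M. t < cmod (W f s)} = \<tau> -` {s \<in> space M. t < cmod (f s)} \<inter> space M"
    using norm_W \<tau>_involution(1) by auto
  moreover have "{s \<in> space M. t < cmod (f s)} \<in> sets M" by measurable
  ultimately have "emeasure M {s \<in> space M. t < cmod (W f s)} = emeasure M {s \<in> space M. t < cmod (f s)}"
    by (simp only: emeasure_vimage_\<tau>)
  then show "emeasure M {s \<in> space M. t < cmod (rep (cls M (W f)) s)} = emeasure M {s \<in> space M. t < cmod (rep (cls M f) s)}"
    by (simp only: rep W_measurable assms)
qed

lemma W_rearrangement_invariant:
  assumes "rearrangement_invariant M X" "f \<in> fmem M X"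
  shows "W f \<in> fmem M X" "fnrm M X (W f) = fnrm M X f"
proof -
  have m [measurable]: "f \<in> borel_measurable M" using assms(2) by (rule fmemD)
  have "cls M (W f) \<in> L0 M" "cls M f \<in> L0 M" by (auto intro: cls_in_L0)
  then show "W f \<in> fmem M X" "fnrm M X (W f) = fnrm M X f"
    using assms equimeasurable_W[OF m] unfolding rearrangement_invariant_def fmem_def fnrm_def by auto
qed

lemma W_L2:
  assumes "f \<in> fmem M (L2_space M)"
  shows "W f \<in> fmem M (L2_space M)" "fnrm M (L2_space M) (W f) = fnrm M (L2_space M) f"
proof -
  have m [measurable]: "f \<in> borel_measurable M" using assms by (rule fmemD)
  have ae: "(cmod (W f s))\<^sup>2 = (cmod (f (\<tau> s)))\<^sup>2" if "s \<in> space M" for s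
    using norm_W[OF that] by simp
  have i: "integrable M (\<lambda>s. (cmod (f s))\<^sup>2)"
    using fmemD(2)[OF assms] by (simp add: L2_space_cls)
  have "integrable M (\<lambda>s. (cmod (f (\<tau> s)))\<^sup>2)"
    using i by (subst (asm) distr_\<tau>[symmetric], subst (asm) integrable_distr_eq) auto
  then have "integrable M (\<lambda>s. (cmod (W f s))\<^sup>2)"
    using ae by (subst Bochner_Integration.integrable_cong[OF refl]) auto
  then show "W f \<in> fmem M (L2_space M)" by (simp add: fmem_def L2_space_cls)
  have "(\<integral>s. (cmod (f (\<tau> s)))\<^sup>2 \<partial>M) = (\<integral>s. (cmod (f s))\<^sup>2 \<partial>distr M M \<tau>)"
    by (subst integral_distr) auto
  then show "fnrm M (L2_space M) (W f) = fnrm M (L2_space M) f"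
    using ae by (simp add: fnrm_def L2_space_cls distr_\<tau> cong: Bochner_Integration.integral_cong)
qed

text \<open>Rearrangement invariance is given for the two summands, so the argument works on
  decompositions: \<open>\<omega>\<close> carries each decomposition of \<open>cls M f\<close> to
  one of \<open>cls M (W f)\<close> with the same total norm.\<close>

lemma W_sum_space:
  assumes X: "normed_subspace M X0" "normed_subspace M X1"
    and ri: "rearrangement_invariant M X0" "rearrangement_invariant M X1"
    and f: "f \<in> fmem M (sum_space M X0 X1)"
  shows "W f \<in> fmem M (sum_space M X0 X1)" "fnrm M (sum_space M X0 X1) (W f) \<le> fnrm M (sum_space M X0 X1) f"
proof -
  let ?S = "sum_space M X0 X1"
  note m [measurable] = fmemD(1)[OF f]
  have split: "cls M (W f) = L0_add M (\<omega> F0) (\<omega> F1) \<and> \<omega> F0 \<in> carr X0 \<and> \<omega> F1 \<in> carr X1 \<and>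
      nrm X0 (\<omega> F0) = nrm X0 F0 \<and> nrm X1 (\<omega> F1) = nrm X1 F1"
    if F: "F0 \<in> carr X0" "F1 \<in> carr X1" "cls M f = L0_add M F0 F1" for F0 F1
  proof -
    note r0 = fmem_rep[OF X(1) F(1)] and r1 = fmem_rep[OF X(2) F(2)]
    note [measurable] = fmemD(1)[OF r0(1)] fmemD(1)[OF r1(1)]
    have "cls M (W f) = \<omega> (cls M f)" by (simp add: \<omega>_cls)
    also have "cls M f = cls M (\<lambda>s. rep F0 s + rep F1 s)"
      unfolding F(3) L0_add_def ..
    also have "\<omega> \<dots> = cls M (\<lambda>s. W (rep F0) s + W (rep F1) s)"
      by (simp add: \<omega>_cls W_linear)
    also have "\<dots> = L0_add M (\<omega> F0) (\<omega> F1)"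
      unfolding \<omega>_rep by (simp add: L0_add_cls)
    finally show ?thesis
      using W_rearrangement_invariant[OF ri(1) r0(1)] W_rearrangement_invariant[OF ri(2) r1(1)]
      unfolding \<omega>_rep by (simp add: fmem_def fnrm_def r0(2) r1(2))
  qed
  obtain F0 F1 where "F0 \<in> carr X0" "F1 \<in> carr X1" "cls M f = L0_add M F0 F1"
    using fmemD(2)[OF f] by (rule sum_spaceE[OF X])
  then show "W f \<in> fmem M ?S" using split[of F0 F1] by (simp add: fmem_def sum_spaceI[OF X])
  show "fnrm M ?S (W f) \<le> fnrm M ?S f"
  proof (rule field_le_epsilon)
    fix e :: real assume e: "0 < e"
    obtain F0 F1 where F: "F0 \<in> carr X0" "F1 \<in> carr X1" "cls M f = L0_add M F0 F1"
      "nrm X0 F0 + nrm X1 F1 < nrm ?S (cls M f) + e"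
      using sum_norm_approx[OF X fmemD(2)[OF f] e] .
    then show "fnrm M ?S (W f) \<le> fnrm M ?S f + e"
      using split[OF F(1-3)] sum_norm_le[OF X, of "\<omega> F0" "\<omega> F1"] by (simp add: fnrm_def)
  qed
qed

end

section \<open>The commutator estimate\<close>

lemma calderon_norm:
  assumes X: "normed_subspace M X0" "normed_subspace M X1" and g: "g \<in> carr (calderon_space M X0 X1)"
  shows "nrm X0 (g (Complex 0 t)) \<le> nrm (calderon_space M X0 X1) g"
    and "nrm X1 (g (Complex 1 t)) \<le> nrm (calderon_space M X0 X1) g"
    and "0 \<le> nrm (calderon_space M X0 X1) g"
proof -
  have b0: "boundary_condition M X0 0 g" and b1: "boundary_condition M X1 1 g"
    using g by (auto simp: calderon_space_def)
  obtain K0 where K0: "\<And>t. nrm X0 (g (Complex 0 t)) \<le> K0"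
    using b0 by (auto simp: boundary_condition_def bounded_map_on_def)
  obtain K1 where K1: "\<And>t. nrm X1 (g (Complex 1 t)) \<le> K1"
    using b1 by (auto simp: boundary_condition_def bounded_map_on_def)
  let ?A = "range (\<lambda>t. nrm X0 (g (Complex 0 t))) \<union> range (\<lambda>t. nrm X1 (g (Complex 1 t)))"
  have bdd: "bdd_above ?A"
    by (rule bdd_aboveI[of _ "max K0 K1"]) (auto intro: max.coboundedI1 max.coboundedI2 K0 K1)
  have eq: "nrm (calderon_space M X0 X1) g = Sup ?A" by (simp add: calderon_space_def)
  show le: "nrm X0 (g (Complex 0 t)) \<le> nrm (calderon_space M X0 X1) g" for t
    unfolding eq by (rule cSup_upper[OF _ bdd]) blast
  show "nrm X1 (g (Complex 1 t)) \<le> nrm (calderon_space M X0 X1) g"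
    unfolding eq by (rule cSup_upper[OF _ bdd]) blast
  have "g (Complex 0 0) \<in> carr X0" using b0 by (simp add: boundary_condition_def)
  from normed_subspaceD(5)[OF X(1) this] le[of 0] show "0 \<le> nrm (calderon_space M X0 X1) g" by simp
qed

lemma calderon_norm_le:
  assumes "\<And>t. nrm X0 (g (Complex 0 t)) \<le> K" "\<And>t. nrm X1 (g (Complex 1 t)) \<le> K"
  shows "nrm (calderon_space M X0 X1) g \<le> K"
proof -
  have "nrm (calderon_space M X0 X1) g =
      Sup (range (\<lambda>t. nrm X0 (g (Complex 0 t))) \<union> range (\<lambda>t. nrm X1 (g (Complex 1 t))))"
    by (simp add: calderon_space_def)
  also have "\<dots> \<le> K" by (rule cSup_least) (use assms in auto)
  finally show ?thesis .
qed

lemma interpolation_norm_le: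
  assumes X: "normed_subspace M X0" "normed_subspace M X1" and g: "g \<in> carr (calderon_space M X0 X1)"
  shows "g (complex_of_real \<theta>) \<in> carr (interpolation_space M X0 X1 \<theta>)"
    and "nrm (interpolation_space M X0 X1 \<theta>) (g (complex_of_real \<theta>)) \<le> nrm (calderon_space M X0 X1) g"
proof -
  show "g (complex_of_real \<theta>) \<in> carr (interpolation_space M X0 X1 \<theta>)"
    using g by (simp add: interpolation_space_def)
  show "nrm (interpolation_space M X0 X1 \<theta>) (g (complex_of_real \<theta>)) \<le> nrm (calderon_space M X0 X1) g"
    unfolding interpolation_space_def nspace.simps
  proof (rule cInf_lower)
    show "nrm (calderon_space M X0 X1) g \<in> {nrm (calderon_space M X0 X1) h | h.
        h \<in> carr (calderon_space M X0 X1) \<and> h (complex_of_real \<theta>) = g (complex_of_real \<theta>)}"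
      using g by blast
    show "bdd_below {nrm (calderon_space M X0 X1) h | h.
        h \<in> carr (calderon_space M X0 X1) \<and> h (complex_of_real \<theta>) = g (complex_of_real \<theta>)}"
      using calderon_norm(3)[OF X] by (intro bdd_belowI[of _ 0]) blast
  qed
qed

text \<open>This is the standard fact that the derivative at \<open>\<theta>\<close> maps the kernel
  of evaluation at \<open>\<theta>\<close> boundedly into the interpolation space. The quotient by
  \<open>z - \<theta>\<close> is a lift of the derivative, and the constant is the reciprocal of the
  distance from \<open>\<theta>\<close> to the boundary of the strip.\<close>

lemma kernel_derivative:
  assumes X: "normed_subspace M X0" "normed_subspace M X1" "normed_subspace M (sum_space M X0 X1)"
    and H: "calderon_fun M X0 X1 H" and \<theta>: "0 < \<theta>" "\<theta> < 1"
    and zero: "fnrm M (sum_space M X0 X1) (H (complex_of_real \<theta>)) = 0"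
    and K: "\<And>t. fnrm M X0 (H (Complex 0 t)) \<le> K" "\<And>t. fnrm M X1 (H (Complex 1 t)) \<le> K"
    and c: "function_seminorm.expands (fmem M (sum_space M X0 X1)) (fnrm M (sum_space M X0 X1)) H c (complex_of_real \<theta>) r"
    and r: "ball (complex_of_real \<theta>) r \<subseteq> interior strip"
  shows "cls M (c 1) \<in> carr (interpolation_space M X0 X1 \<theta>)"
    and "nrm (interpolation_space M X0 X1 \<theta>) (cls M (c 1)) \<le> K / min \<theta> (1 - \<theta>)"
proof -
  let ?S = "sum_space M X0 X1" and ?a = "complex_of_real \<theta>"
  interpret S: function_seminorm "fmem M ?S" "fnrm M ?S" by (rule function_seminorm_fnrm[OF X(3)])
  interpret N0: function_seminorm "fmem M X0" "fnrm M X0" by (rule function_seminorm_fnrm[OF X(1)])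
  have mH: "H z \<in> fmem M ?S" if "z \<in> strip" for z
    using H that by (auto simp: calderon_fun_def)
  obtain L where L: "\<And>z. z \<in> strip \<Longrightarrow> fnrm M ?S (H z) \<le> L"
    using H unfolding calderon_fun_def by meson
  have co: "S.cont strip H" and an: "S.analytic (interior strip) H"
    and b0: "boundary_fun M X0 0 H" and b1: "boundary_fun M X1 1 H"
    using H by (auto simp: calderon_fun_def)
  have a_strip: "?a \<in> strip" using \<theta> by (simp add: strip_def)
  have a0: "Re ?a \<noteq> 0" and a1: "Re ?a \<noteq> 1" using \<theta> by auto
  define k where "k = removed ?a (c 1) H"
  have c1: "c 1 \<in> fmem M ?S" using c by (simp add: S.expands_def)
  have mk: "k z \<in> fmem M ?S" if "z \<in> strip" for z
    using mH[OF that] c1 unfolding k_def removed_def by (simp only: S.scale_mem split: if_split) simp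
  have k: "calderon_fun M X0 X1 k"
    unfolding calderon_fun_def
  proof (intro conjI ballI)
    show "k z \<in> fmem M ?S" if "z \<in> strip" for z by (rule mk[OF that])
    show "\<exists>K. \<forall>z\<in>strip. fnrm M ?S (k z) \<le> K"
      unfolding k_def by (rule S.bounded_removed[OF mH co c zero a_strip L])
    show "S.cont strip k"
      unfolding k_def by (rule S.cont_removed[OF mH co c zero])
    show "S.analytic (interior strip) k"
      unfolding k_def by (rule S.analytic_removed[OF an c r zero])
    show "boundary_fun M X0 0 k"
      unfolding k_def by (rule boundary_fun_removed(1)[OF X(1) b0 a0 K(1)])
    show "boundary_fun M X1 1 k"
      unfolding k_def by (rule boundary_fun_removed(1)[OF X(2) b1 a1 K(2)])
  qed
  define g where "g z = cls M (k z)" for z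
  have g: "g \<in> carr (calderon_space M X0 X1)"
    using calderon_iff[OF X, of k g] k fmemD(1)[OF mk] by (simp add: g_def)
  have ga: "g ?a = cls M (c 1)" by (simp add: g_def k_def removed_def)
  \<comment> \<open>\<open>K\<close> dominates a seminorm value and is therefore nonnegative, which
    is needed to enlarge \<open>K / \<theta>\<close> and \<open>K / (1 - \<theta>)\<close> to the
    common bound.\<close>
  have "0 \<le> fnrm M X0 (H (Complex 0 0))"
    using b0 by (intro N0.nonneg) (simp add: boundary_fun_def)
  with K(1)[of 0] have K0: "0 \<le> K" by linarith
  have "nrm (calderon_space M X0 X1) g \<le> K / min \<theta> (1 - \<theta>)"
  proof (rule calderon_norm_le)
    fix t
    have "nrm X0 (g (Complex 0 t)) \<le> K / \<bar>Re ?a - 0\<bar>"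
      using boundary_fun_removed(2)[OF X(1) b0 a0 K(1)] unfolding g_def k_def fnrm_def .
    also have "\<dots> \<le> K / min \<theta> (1 - \<theta>)" using K0 \<theta> by (intro divide_left_mono) auto
    finally show "nrm X0 (g (Complex 0 t)) \<le> K / min \<theta> (1 - \<theta>)" .
    have "nrm X1 (g (Complex 1 t)) \<le> K / \<bar>Re ?a - 1\<bar>"
      using boundary_fun_removed(2)[OF X(2) b1 a1 K(2)] unfolding g_def k_def fnrm_def .
    also have "\<dots> \<le> K / min \<theta> (1 - \<theta>)" using K0 \<theta> by (intro divide_left_mono) auto
    finally show "nrm X1 (g (Complex 1 t)) \<le> K / min \<theta> (1 - \<theta>)" .
  qed
  with interpolation_norm_le[OF X(1,2) g, of \<theta>]
  show "cls M (c 1) \<in> carr (interpolation_space M X0 X1 \<theta>)"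
    "nrm (interpolation_space M X0 X1 \<theta>) (cls M (c 1)) \<le> K / min \<theta> (1 - \<theta>)"
    by (simp_all add: ga)
qed

text \<open>One coefficient family serves two purposes: it expands the chosen representatives near
  \<open>\<theta>\<close>, and its entry \<open>c 1\<close> represents the derivative there, so
  differences of derivatives can be formed on coefficients.\<close>

lemma calderon_representatives:
  assumes X: "normed_subspace M X0" "normed_subspace M X1" "normed_subspace M (sum_space M X0 X1)"
    and g: "g \<in> carr (calderon_space M X0 X1)" and \<theta>: "0 < \<theta>" "\<theta> < 1"
  obtains G c r where "calderon_fun M X0 X1 G" "\<And>z. z \<in> strip \<Longrightarrow> g z = cls M (G z)"
    "ball (complex_of_real \<theta>) r \<subseteq> interior strip"
    "function_seminorm.expands (fmem M (sum_space M X0 X1)) (fnrm M (sum_space M X0 X1)) G c (complex_of_real \<theta>) r"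
    "norm_deriv M (sum_space M X0 X1) g (complex_of_real \<theta>) = cls M (c 1)"
proof -
  let ?S = "sum_space M X0 X1"
  interpret S: function_seminorm "fmem M ?S" "fnrm M ?S" by (rule function_seminorm_fnrm[OF X(3)])
  define G where "G z = rep (g z)" for z
  have gS: "g z \<in> carr ?S" if "z \<in> strip" for z
    using g that by (simp add: calderon_space_def)
  have G: "G z \<in> fmem M ?S" "g z = cls M (G z)" if "z \<in> strip" for z
    using fmem_rep[OF X(3) gS[OF that]] by (simp_all add: G_def)
  have cG: "calderon_fun M X0 X1 G"
    using calderon_iff[OF X, of G g] G(2) fmemD(1)[OF G(1)] g by simp
  have "complex_of_real \<theta> \<in> interior strip" using \<theta> by (intro interior_stripI) auto
  then obtain r c where r: "ball (complex_of_real \<theta>) r \<subseteq> interior strip" "S.expands G c (complex_of_real \<theta>) r"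
    using cG by (auto simp: calderon_fun_def S.analytic_def)
  have "norm_deriv M ?S g (complex_of_real \<theta>) = cls M (c 1)"
    using r(1) interior_subset[of strip] by (intro norm_deriv_expands[OF X(3) r(2)] G(2)) auto
  then show ?thesis using that[OF cG G(2) r] by blast
qed

context natural_structure
begin

text \<open>The lifts \<open>g\<close> and \<open>h\<close> are arbitrary, so the selection
  \<open>B\<close> enters only through the norms of its values. The difference
  \<open>\<omega> g - h\<close> lies in the kernel of evaluation at \<open>\<theta>\<close>, its
  derivative there is the commutator, and on the boundary its norm is at most the sum of the two
  Calderon norms.\<close>

lemma commutator_estimate:
  assumes X: "normed_subspace M X0" "normed_subspace M X1" "normed_subspace M (sum_space M X0 X1)"
    and ri: "rearrangement_invariant M X0" "rearrangement_invariant M X1"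
    and \<theta>: "0 < \<theta>" "\<theta> < 1"
    and g: "g \<in> carr (calderon_space M X0 X1)" and h: "h \<in> carr (calderon_space M X0 X1)"
    and gh: "h (complex_of_real \<theta>) = \<omega> (g (complex_of_real \<theta>))"
  defines "d \<equiv> \<lambda>g. norm_deriv M (sum_space M X0 X1) g (complex_of_real \<theta>)"
  shows "d g \<in> carr (sum_space M X0 X1)"
    and "L0_diff M (\<omega> (d g)) (d h) \<in> carr (interpolation_space M X0 X1 \<theta>)"
    and "nrm (interpolation_space M X0 X1 \<theta>) (L0_diff M (\<omega> (d g)) (d h)) \<le>
      (nrm (calderon_space M X0 X1) g + nrm (calderon_space M X0 X1) h) / min \<theta> (1 - \<theta>)"
proof -
  let ?S = "sum_space M X0 X1" and ?a = "complex_of_real \<theta>" and ?C = "calderon_space M X0 X1"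
  interpret S: function_seminorm "fmem M ?S" "fnrm M ?S" by (rule function_seminorm_fnrm[OF X(3)])
  obtain G b r1 where G: "calderon_fun M X0 X1 G" "\<And>z. z \<in> strip \<Longrightarrow> g z = cls M (G z)"
    "ball ?a r1 \<subseteq> interior strip" "S.expands G b ?a r1" "d g = cls M (b 1)"
    by (rule calderon_representatives[OF X g \<theta>]) (rule that[unfolded d_def], assumption+)
  obtain H c r2 where H: "calderon_fun M X0 X1 H" "\<And>z. z \<in> strip \<Longrightarrow> h z = cls M (H z)"
    "ball ?a r2 \<subseteq> interior strip" "S.expands H c ?a r2" "d h = cls M (c 1)"
    by (rule calderon_representatives[OF X h \<theta>]) (rule that[unfolded d_def], assumption+)
  have b1: "b 1 \<in> fmem M ?S" and c1: "c 1 \<in> fmem M ?S"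
    using G(4) H(4) by (simp_all add: S.expands_def)
  show "d g \<in> carr ?S" using fmemD(2)[OF b1] by (simp add: G)
  have W_iso: "W f \<in> fmem M Y \<and> fnrm M Y (W f) \<le> fnrm M Y f"
    if "Y \<in> {X0, X1, ?S}" "f \<in> fmem M Y" for Y f
    using that W_rearrangement_invariant[OF ri(1), of f] W_rearrangement_invariant[OF ri(2), of f]
      W_sum_space[OF X(1,2) ri, of f] by auto
  define D where "D z s = W (G z) s - H z s" for z s
  have D: "calderon_fun M X0 X1 D"
    unfolding D_def by (intro calderon_fun_diff X calderon_fun_wcomp W_iso G(1) H(1))
  define r where "r = min r1 r2"
  have rpos: "0 < r" using S.expands_radius[OF G(4)] S.expands_radius[OF H(4)] by (simp add: r_def)
  have eG: "S.expands G b ?a r" and eH: "S.expands H c ?a r"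
    using rpos by (auto intro!: S.expands_shrink[OF G(4)] S.expands_shrink[OF H(4)] simp: r_def)
  have WS: "W f \<in> fmem M ?S" "fnrm M ?S (W f) \<le> fnrm M ?S f" if "f \<in> fmem M ?S" for f
    using W_iso[OF _ that] by auto
  have eD: "S.expands D (\<lambda>n s. W (b n) s - c n s) ?a r"
    unfolding D_def by (rule S.expands_diff[OF S.expands_wcomp[OF WS eG] eH])
  have rs: "ball ?a r \<subseteq> interior strip" using G(3) by (auto simp: r_def)
  have as: "?a \<in> strip" using \<theta> by (simp add: strip_def)
  have mGa: "G ?a \<in> borel_measurable M" and mHa: "H ?a \<in> borel_measurable M"
    using G(1) H(1) as by (auto simp: calderon_fun_def fmem_def)
  \<comment> \<open>The representatives of \<open>g\<close> and \<open>h\<close> were chosen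
    separately, so \<open>D\<close> vanishes at \<open>\<theta>\<close> only almost everywhere;
    hence the hypothesis of seminorm zero in the division lemmas.\<close>
  have "cls M (W (G ?a)) = cls M (H ?a)"
    using gh G(2)[OF as] H(2)[OF as] by (simp add: \<omega>_cls mGa)
  then have "AE s in M. W (G ?a) s = H ?a s"
    using cls_eq_iff[OF W_measurable[OF mGa] mHa] by simp
  then have "cls M (D ?a) = L0_zero M"
    unfolding L0_zero_def D_def using W_measurable[OF mGa] mHa by (subst cls_eq_iff) auto
  then have zero: "fnrm M ?S (D ?a) = 0"
    using normed_subspaceD(6)[OF X(3) normed_subspaceD(2)[OF X(3)]] by (simp add: fnrm_def)
  have bound: "fnrm M Y (D (Complex j t)) \<le> nrm ?C g + nrm ?C h"
    if Y: "normed_subspace M Y" "Y \<in> {X0, X1, ?S}" and GH: "boundary_fun M Y j G" "boundary_fun M Y j H"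
      and st: "Complex j t \<in> strip"
      and le: "nrm Y (g (Complex j t)) \<le> nrm ?C g" "nrm Y (h (Complex j t)) \<le> nrm ?C h" for Y j t
  proof -
    interpret N: function_seminorm "fmem M Y" "fnrm M Y" by (rule function_seminorm_fnrm[OF Y(1)])
    have m: "G (Complex j t) \<in> fmem M Y" "H (Complex j t) \<in> fmem M Y"
      using GH by (auto simp: boundary_fun_def)
    have "fnrm M Y (D (Complex j t)) \<le> fnrm M Y (W (G (Complex j t))) + fnrm M Y (H (Complex j t))"
      unfolding D_def using W_iso[OF Y(2) m(1)] m(2) by (intro N.triangle_diff) auto
    also have "\<dots> \<le> fnrm M Y (G (Complex j t)) + fnrm M Y (H (Complex j t))"
      using W_iso[OF Y(2) m(1)] by simp
    also have "\<dots> \<le> nrm ?C g + nrm ?C h"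
      using le by (simp add: fnrm_def G(2)[OF st] H(2)[OF st])
    finally show ?thesis .
  qed
  have K0: "fnrm M X0 (D (Complex 0 t)) \<le> nrm ?C g + nrm ?C h" for t
    using G(1) H(1) by (intro bound X boundary_mem_strip calderon_norm g h) (auto simp: calderon_fun_def)
  have K1: "fnrm M X1 (D (Complex 1 t)) \<le> nrm ?C g + nrm ?C h" for t
    using G(1) H(1) by (intro bound X boundary_mem_strip calderon_norm g h) (auto simp: calderon_fun_def)
  have "L0_diff M (\<omega> (d g)) (d h) = cls M (\<lambda>s. W (b 1) s - c 1 s)"
    unfolding G(5) H(5) using fmemD(1)[OF b1] fmemD(1)[OF c1] by (simp add: \<omega>_cls L0_diff_cls)
  then show "L0_diff M (\<omega> (d g)) (d h) \<in> carr (interpolation_space M X0 X1 \<theta>)"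
    and "nrm (interpolation_space M X0 X1 \<theta>) (L0_diff M (\<omega> (d g)) (d h)) \<le> (nrm ?C g + nrm ?C h) / min \<theta> (1 - \<theta>)"
    using kernel_derivative[OF X D \<theta> zero K0 K1 eD rs] by simp_all
qed

end

text \<open>Integrate \<open>|f + g|^2 \<le> 2 * |f|^2 + 2 * |g|^2\<close> and use
  \<open>2 * x + 2 * y \<le> (2 * (sqrt x + sqrt y))^2\<close>. The factor 2 is harmless, since the
  bound only feeds into the boundedness of \<open>\<beta>\<close>.\<close>

lemma L2_space_add:
  assumes "F \<in> carr (L2_space M)" "G \<in> carr (L2_space M)"
  shows "L0_add M F G \<in> carr (L2_space M)"
    and "nrm (L2_space M) (L0_add M F G) \<le> 2 * (nrm (L2_space M) F + nrm (L2_space M) G)"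
proof -
  have L: "F \<in> L0 M" "G \<in> L0 M" using assms by (auto simp: L2_space_def)
  define f g where "f = rep F" and "g = rep G"
  have f: "f \<in> borel_measurable M" "cls M f = F" and g: "g \<in> borel_measurable M" "cls M g = G"
    using L by (simp_all add: f_def g_def rep_measurable cls_rep)
  have i: "integrable M (\<lambda>s. (cmod (f s))\<^sup>2)" "integrable M (\<lambda>s. (cmod (g s))\<^sup>2)"
    using assms L2_space_cls(1)[OF f(1)] L2_space_cls(1)[OF g(1)] f g by auto
  have mfg: "(\<lambda>s. f s + g s) \<in> borel_measurable M" using f g by simp
  have FG: "L0_add M F G = cls M (\<lambda>s. f s + g s)" by (simp add: L0_add_def f_def g_def)
  have le: "(cmod (f s + g s))\<^sup>2 \<le> 2 * (cmod (f s))\<^sup>2 + 2 * (cmod (g s))\<^sup>2" for s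
  proof -
    have "(cmod (f s + g s))\<^sup>2 \<le> (cmod (f s) + cmod (g s))\<^sup>2"
      by (intro power_mono norm_triangle_ineq) simp
    also have "\<dots> \<le> 2 * (cmod (f s))\<^sup>2 + 2 * (cmod (g s))\<^sup>2"
      using sum_squares_bound[of "cmod (f s)" "cmod (g s)"] by (simp add: power2_sum)
    finally show ?thesis .
  qed
  have i2: "integrable M (\<lambda>s. 2 * (cmod (f s))\<^sup>2 + 2 * (cmod (g s))\<^sup>2)" using i by simp
  have ifg: "integrable M (\<lambda>s. (cmod (f s + g s))\<^sup>2)"
    by (rule Bochner_Integration.integrable_bound[OF i2]) (use mfg le in auto)
  then show "L0_add M F G \<in> carr (L2_space M)" unfolding FG by (simp add: L2_space_cls mfg)
  define x y where "x = (\<integral>s. (cmod (f s))\<^sup>2 \<partial>M)" and "y = (\<integral>s. (cmod (g s))\<^sup>2 \<partial>M)"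
  have xy: "0 \<le> x" "0 \<le> y" by (auto simp: x_def y_def)
  have "(\<integral>s. (cmod (f s + g s))\<^sup>2 \<partial>M) \<le> (\<integral>s. 2 * (cmod (f s))\<^sup>2 + 2 * (cmod (g s))\<^sup>2 \<partial>M)"
    by (intro integral_mono ifg i2 le)
  also have "\<dots> = 2 * x + 2 * y" using i by (simp add: x_def y_def)
  also have "\<dots> \<le> (2 * (sqrt x + sqrt y))\<^sup>2"
    using xy by (simp add: power2_sum power_mult_distrib)
  finally have "sqrt (\<integral>s. (cmod (f s + g s))\<^sup>2 \<partial>M) \<le> 2 * (sqrt x + sqrt y)"
    using xy by (intro real_le_lsqrt) auto
  then show "nrm (L2_space M) (L0_add M F G) \<le> 2 * (nrm (L2_space M) F + nrm (L2_space M) G)"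
    unfolding FG unfolding f(2)[symmetric] g(2)[symmetric] by (simp add: L2_space_cls mfg f(1) g(1) x_def y_def)
qed

section \<open>The diagonal operator on the derived space\<close>

context natural_structure
begin

lemma \<omega>_zero: "\<omega> (L0_zero M) = L0_zero M"
  unfolding L0_zero_def by (simp add: \<omega>_cls) (simp add: wcomp_def)

lemma \<omega>_add: "F \<in> L0 M \<Longrightarrow> G \<in> L0 M \<Longrightarrow> \<omega> (L0_add M F G) = L0_add M (\<omega> F) (\<omega> G)"
  by (elim L0E) (simp add: L0_cls_simps \<omega>_cls W_linear)

lemma \<omega>_scale: "F \<in> L0 M \<Longrightarrow> \<omega> (L0_scale M c F) = L0_scale M c (\<omega> F)"
  by (elim L0E) (simp add: L0_cls_simps \<omega>_cls W_linear)

lemma \<omega>_\<omega>: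
  assumes "F \<in> L0 M"
  shows "\<omega> (\<omega> F) = L0_scale M (-1) F"
  using assms
proof (rule L0E)
  fix f assume f: "f \<in> borel_measurable M" "F = cls M f"
  show ?thesis
    unfolding f(2) using f(1)
    by (simp add: \<omega>_cls L0_scale_cls) (subst cls_eq_iff; auto simp: W_W intro: AE_I2)
qed

lemma \<omega>_L2:
  assumes "F \<in> carr (L2_space M)"
  shows "\<omega> F \<in> carr (L2_space M)" "nrm (L2_space M) (\<omega> F) = nrm (L2_space M) F"
proof -
  have "F \<in> L0 M" using assms by (simp add: L2_space_def)
  then have "rep F \<in> fmem M (L2_space M)" "cls M (rep F) = F"
    using assms by (simp_all add: fmem_def rep_measurable cls_rep)
  then show "\<omega> F \<in> carr (L2_space M)" "nrm (L2_space M) (\<omega> F) = nrm (L2_space M) F"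
    using W_L2[of "rep F"] unfolding \<omega>_rep by (auto simp: fmem_def fnrm_def)
qed

lemma \<omega>_sum_space:
  assumes "normed_subspace M X0" "normed_subspace M X1" "normed_subspace M (sum_space M X0 X1)"
    and "rearrangement_invariant M X0" "rearrangement_invariant M X1" "F \<in> carr (sum_space M X0 X1)"
  shows "\<omega> F \<in> carr (sum_space M X0 X1)"
  unfolding \<omega>_rep using W_sum_space(1)[OF assms(1,2,4,5)] fmem_rep[OF assms(3,6)] by (auto simp: fmem_def)

text \<open>Linearity and the square come from \<open>\<omega>\<close> alone. Boundedness rests on
  the splitting \<open>\<omega> w - \<Omega> (\<omega> x) = \<omega> (w - \<Omega> x) + (\<omega>
  (\<Omega> x) - \<Omega> (\<omega> x))\<close>: the first part has the norm of
  \<open>w - \<Omega> x\<close>, the second is the commutator. The factor 2 of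
  \<open>L2_space_add\<close> leads to the bound \<open>2 + 2 * \<bar>C\<bar>\<close>.\<close>

lemma diagonal_complex_structure:
  assumes S: "carr Y \<subseteq> L0 M" "\<And>F. F \<in> carr Y \<Longrightarrow> \<omega> F \<in> carr Y"
    and \<Omega>: "\<And>x. x \<in> carr (L2_space M) \<Longrightarrow> \<Omega> x \<in> carr Y"
    and comm: "\<And>x. x \<in> carr (L2_space M) \<Longrightarrow> L0_diff M (\<omega> (\<Omega> x)) (\<Omega> (\<omega> x)) \<in> carr (L2_space M)"
      "\<And>x. x \<in> carr (L2_space M) \<Longrightarrow> nrm (L2_space M) (L0_diff M (\<omega> (\<Omega> x)) (\<Omega> (\<omega> x))) \<le> C * nrm (L2_space M) x"
  shows "complex_structure M (derived_space M Y (L2_space M) \<Omega>) (\<lambda>(w, x). (\<omega> w, \<omega> x))"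
proof -
  let ?D = "derived_space M Y (L2_space M) \<Omega>" and ?n = "nrm (L2_space M)"
  have nn: "0 \<le> ?n x" for x by (simp add: L2_space_def)
  have L0: "w \<in> L0 M" "x \<in> L0 M" if "(w, x) \<in> carr ?D" for w x
    using that S(1) by (auto simp: derived_space_def L2_space_def)
  have main: "(\<omega> w, \<omega> x) \<in> carr ?D \<and> nrm ?D (\<omega> w, \<omega> x) \<le> (2 + 2 * \<bar>C\<bar>) * nrm ?D (w, x)"
    if v: "(w, x) \<in> carr ?D" for w x
  proof -
    have w: "w \<in> carr Y" and x: "x \<in> carr (L2_space M)" and d: "L0_diff M w (\<Omega> x) \<in> carr (L2_space M)"
      using v by (auto simp: derived_space_def)
    have wL: "w \<in> L0 M" and oL: "\<Omega> x \<in> L0 M" and ooL: "\<Omega> (\<omega> x) \<in> L0 M"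
      using w S(1) \<Omega>[OF x] \<Omega>[OF \<omega>_L2(1)[OF x]] by auto
    have eq: "L0_diff M (\<omega> w) (\<Omega> (\<omega> x)) =
      L0_add M (\<omega> (L0_diff M w (\<Omega> x))) (L0_diff M (\<omega> (\<Omega> x)) (\<Omega> (\<omega> x)))"
    proof -
      obtain f where f: "f \<in> borel_measurable M" "w = cls M f" using wL by (rule L0E)
      obtain h where h: "h \<in> borel_measurable M" "\<Omega> x = cls M h" using oL by (rule L0E)
      obtain k where k: "k \<in> borel_measurable M" "\<Omega> (\<omega> x) = cls M k" using ooL by (rule L0E)
      show ?thesis
        unfolding f(2) h(2) k(2) using f(1) h(1) k(1) by (simp add: L0_cls_simps \<omega>_cls W_linear)
    qed
    note add = L2_space_add[OF \<omega>_L2(1)[OF d] comm(1)[OF x]]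
    have mem: "(\<omega> w, \<omega> x) \<in> carr ?D"
      using S(2)[OF w] \<omega>_L2(1)[OF x] add(1) by (simp add: derived_space_def eq)
    have "nrm ?D (\<omega> w, \<omega> x) \<le> ?n x + 2 * (?n (L0_diff M w (\<Omega> x)) + \<bar>C\<bar> * ?n x)"
    proof -
      \<comment> \<open>\<open>C\<close> is an arbitrary real number; its absolute value keeps the
        later estimates monotone.\<close>
      have "?n (L0_diff M (\<omega> (\<Omega> x)) (\<Omega> (\<omega> x))) \<le> \<bar>C\<bar> * ?n x"
        using comm(2)[OF x] mult_right_mono[OF abs_ge_self[of C] nn[of x]] by linarith
      then show ?thesis
        using add(2) \<omega>_L2(2)[OF x] \<omega>_L2(2)[OF d] by (simp add: derived_space_def eq)
    qed
    also have "\<dots> \<le> (2 + 2 * \<bar>C\<bar>) * nrm ?D (w, x)"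
      using nn[of x] mult_nonneg_nonneg[OF abs_ge_zero[of C] nn[of "L0_diff M w (\<Omega> x)"]]
      by (simp add: derived_space_def algebra_simps)
    finally show ?thesis using mem by blast
  qed
  show ?thesis
    unfolding complex_structure_def bounded_linear_operator_def
  proof (intro conjI ballI allI exI[of _ "2 + 2 * \<bar>C\<bar>"])
    fix c and u v :: "'s fclass \<times> 's fclass"
    assume v: "v \<in> carr ?D"
    obtain w x where wx: "v = (w, x)" by (cases v)
    note L = L0[OF v[unfolded wx]]
    show "(case v of (w, x) \<Rightarrow> (\<omega> w, \<omega> x)) \<in> carr ?D"
      "nrm ?D (case v of (w, x) \<Rightarrow> (\<omega> w, \<omega> x)) \<le> (2 + 2 * \<bar>C\<bar>) * nrm ?D v"
      using main v by (auto simp: wx)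
    show "(case pair_scale M c v of (w, x) \<Rightarrow> (\<omega> w, \<omega> x)) = pair_scale M c (case v of (w, x) \<Rightarrow> (\<omega> w, \<omega> x))"
      using L by (simp add: wx pair_scale_def \<omega>_scale)
    show "(case (case v of (w, x) \<Rightarrow> (\<omega> w, \<omega> x)) of (w, x) \<Rightarrow> (\<omega> w, \<omega> x)) = pair_scale M (- 1) v"
      using L by (simp add: wx pair_scale_def \<omega>_\<omega>)
    assume u: "u \<in> carr ?D"
    obtain w' x' where u': "u = (w', x')" by (cases u)
    show "(case pair_add M u v of (w, x) \<Rightarrow> (\<omega> w, \<omega> x)) =
      pair_add M (case u of (w, x) \<Rightarrow> (\<omega> w, \<omega> x)) (case v of (w, x) \<Rightarrow> (\<omega> w, \<omega> x))"
      using L L0[OF u[unfolded u']] by (simp add: wx u' pair_add_def \<omega>_add)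
  qed
qed

end

theorem corollary2p9:
  fixes M :: "'s measure"
    and X0 X1 :: "'s fclass nspace"
    and \<theta> :: real
    and B :: "'s fclass \<Rightarrow> complex \<Rightarrow> 's fclass"
    and S :: "nat \<Rightarrow> 's set"
    and a :: "nat \<Rightarrow> 's \<Rightarrow> 's"
  defines "\<Omega> \<equiv> induced_centralizer M X0 X1 \<theta> B"
    and "\<omega> \<equiv> natural_complex_structure M S a"
  defines "D \<equiv> derived_space M (sum_space M X0 X1) (L2_space M) \<Omega>"
  assumes "sigma_finite_measure M"
    and "natural_structure_data M S a"
    and "koethe_space M X0" and "rearrangement_invariant M X0"
    and "koethe_space M X1" and "rearrangement_invariant M X1"
    and "compatible_couple M X0 X1"
    and "0 < \<theta>" and "\<theta> < 1"
    and "equal_with_equivalent_norms (interpolation_space M X0 X1 \<theta>) (L2_space M)"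
    and "bounded_homogeneous_selection M X0 X1 \<theta> B"
  shows "\<exists>\<beta>. complex_structure M D \<beta> \<and>
             (\<forall>x\<in>carr (L2_space M). \<beta> (x, L0_zero M) = (\<omega> x, L0_zero M)) \<and>
             (\<forall>v\<in>carr D. snd (\<beta> v) = \<omega> (snd v))"
proof -
  interpret natural_structure M S a by standard (rule assms(5))
  let ?S = "sum_space M X0 X1" and ?I = "interpolation_space M X0 X1 \<theta>" and ?C = "calderon_space M X0 X1"
  let ?n = "nrm (L2_space M)"
  have X: "normed_subspace M X0" "normed_subspace M X1"
    using \<open>koethe_space M X0\<close> \<open>koethe_space M X1\<close> by (simp_all add: koethe_space_def banach_subspace_def)
  have XS: "normed_subspace M ?S"
    using \<open>compatible_couple M X0 X1\<close>
    by (intro normed_subspace_sum_space X \<open>sigma_finite_measure M\<close>) (simp_all add: compatible_couple_def)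
  note ri = \<open>rearrangement_invariant M X0\<close> \<open>rearrangement_invariant M X1\<close>
  have I: "carr ?I = carr (L2_space M)"
    using assms(13) by (simp add: equal_with_equivalent_norms_def)
  obtain k K where k: "0 < k" "0 < K" "\<forall>F\<in>carr ?I. k * ?n F \<le> nrm ?I F \<and> nrm ?I F \<le> K * ?n F"
    using assms(13) unfolding equal_with_equivalent_norms_def by (elim conjE exE)
  note equiv = bspec[OF k(3)]
  have B: "B F \<in> carr ?C" "B F (complex_of_real \<theta>) = F" if "F \<in> carr ?I" for F
    using assms(14) that by (simp_all add: bounded_homogeneous_selection_def)
  obtain C where "\<forall>F\<in>carr ?I. nrm ?C (B F) \<le> C * nrm ?I F"
    using assms(14) unfolding bounded_homogeneous_selection_def by (elim conjE exE)
  note C = bspec[OF this]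
  define m where "m = min \<theta> (1 - \<theta>)"
  have m: "0 < m" using \<open>0 < \<theta>\<close> \<open>\<theta> < 1\<close> by (simp add: m_def)
  have nn: "0 \<le> ?n x" for x by (simp add: L2_space_def)
  \<comment> \<open>The selection constant \<open>C\<close> may be negative, hence
    \<open>\<bar>C\<bar>\<close>; \<open>K\<close> converts the interpolation norm to the
    \<open>L2\<close> norm. Nonnegativity of the interpolation norm is read off from the lower
    equivalence bound.\<close>
  have B_le: "nrm ?C (B F) \<le> \<bar>C\<bar> * K * ?n F" if "F \<in> carr (L2_space M)" for F
  proof -
    have F: "F \<in> carr ?I" using that I by simp
    have "0 \<le> nrm ?I F" using equiv[OF F] mult_nonneg_nonneg[OF less_imp_le[OF k(1)] nn[of F]] by linarith
    then have "C * nrm ?I F \<le> \<bar>C\<bar> * nrm ?I F" by (intro mult_right_mono) auto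
    also have "\<dots> \<le> \<bar>C\<bar> * (K * ?n F)" using equiv[OF F] by (intro mult_left_mono) auto
    finally show ?thesis using C[OF F] by (simp add: mult.assoc)
  qed
  \<comment> \<open>Origin of the constant: the lifts of \<open>x\<close> and
    \<open>\<omega> x\<close> cost \<open>\<bar>C\<bar> * K\<close> each, since
    \<open>\<omega>\<close> is isometric on \<open>L2\<close>; division by
    \<open>z - \<theta>\<close> costs \<open>1 / m\<close>, and returning from the interpolation
    norm to \<open>L2\<close> costs \<open>1 / k\<close>.\<close>
  have comm: "\<Omega> x \<in> carr ?S \<and> L0_diff M (\<omega> (\<Omega> x)) (\<Omega> (\<omega> x)) \<in> carr (L2_space M) \<and>
      ?n (L0_diff M (\<omega> (\<Omega> x)) (\<Omega> (\<omega> x))) \<le> (2 * \<bar>C\<bar> * K / (m * k)) * ?n x"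
    if x: "x \<in> carr (L2_space M)" for x
  proof -
    have \<omega>x: "\<omega> x \<in> carr (L2_space M)" "?n (\<omega> x) = ?n x"
      using \<omega>_L2[OF x] by (simp_all add: \<omega>_def)
    have xI: "x \<in> carr ?I" "\<omega> x \<in> carr ?I" using x \<omega>x I by auto
    have "B (\<omega> x) (complex_of_real \<theta>) = natural_complex_structure M S a (B x (complex_of_real \<theta>))"
      using B(2) xI by (simp add: \<omega>_def)
    note est = commutator_estimate[OF X XS ri \<open>0 < \<theta>\<close> \<open>\<theta> < 1\<close> B(1)[OF xI(1)] B(1)[OF xI(2)] this]
    let ?c = "L0_diff M (\<omega> (\<Omega> x)) (\<Omega> (\<omega> x))"
    have c: "?c \<in> carr ?I" "nrm ?I ?c \<le> (nrm ?C (B x) + nrm ?C (B (\<omega> x))) / m" and \<Omega>x: "\<Omega> x \<in> carr ?S"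
      using est by (simp_all add: \<Omega>_def \<omega>_def induced_centralizer_def m_def)
    have "k * ?n ?c \<le> nrm ?I ?c" using equiv[OF c(1)] by simp
    also have "\<dots> \<le> (nrm ?C (B x) + nrm ?C (B (\<omega> x))) / m" by (rule c(2))
    also have "\<dots> \<le> (\<bar>C\<bar> * K * ?n x + \<bar>C\<bar> * K * ?n x) / m"
      using B_le[OF x] B_le[OF \<omega>x(1)] m by (intro divide_right_mono add_mono) (auto simp: \<omega>x(2))
    finally have "?n ?c \<le> (2 * \<bar>C\<bar> * K / (m * k)) * ?n x"
      using k(1) m by (simp add: field_simps)
    with c(1) \<Omega>x I show ?thesis by simp
  qed
  have "complex_structure M D (\<lambda>(w, x). (\<omega> w, \<omega> x))"
    unfolding D_def \<omega>_def
    by (rule diagonal_complex_structure[OF _ \<omega>_sum_space[OF X XS ri], where C = "2 * \<bar>C\<bar> * K / (m * k)"])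
      (use normed_subspaceD(1)[OF XS] comm in \<open>auto simp: \<omega>_def\<close>)
  then show ?thesis
    by (intro exI[of _ "\<lambda>(w, x). (\<omega> w, \<omega> x)"]) (auto simp: \<omega>_def \<omega>_zero)
qed

end
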